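(* Let $K$ be a field and let $I_1,\ldots,I_r$ ($r\geq 1$) be nonzero equigenerated graded ideals in the polynomial ring $K[x_1,\ldots,x_n]$. Then $$\mu(I_1\cdots I_r)\geq \sum_{j=1}^r\mu(I_j)-(r-1).$$ In particular, if $I\subset K[x_1,\ldots,x_n]$ is a nonzero equigenerated graded ideal, then $\mu(I^k)\geq k(\mu(I)-1)+1$ for all $k\geq 0$. Moreover, suppose that $n=2$ and $K$ is infinite. If all the ideals $I_j$ have height $2$ and are contracted, then equality holds in the first inequality; and if $I$ has height $2$ and is contracted, then equality holds in the second inequality for all $k\geq 0$.
   Context: $K[x_1,\ldots,x_n]$ is standard graded. For a graded ideal $L$, $\mu(L)$ is the minimal number of generators of $L$. A graded ideal is equigenerated if it is generated by homogeneous elements all of the same degree. Let $R$ be a two-dimensional polynomial ring over an infinite field, with graded maximal ideal $\mathfrak{m}$. A proper graded ideal $L\subset R$ is called contracted if there exists $x\in\mathfrak{m}\setminus\mathfrak{m}^2$ such that $L=LT\cap R$, where $T=R[\mathfrak{m}/x]$ (the subring of the fraction field of $R$ generated over $R$ by the elements $a/x$ with $a\in\mathfrak{m}$). *)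

theory Defs
  imports
    "HOL-Library.Poly_Mapping"
    "HOL-Library.Extended_Nat"
    "HOL-Computational_Algebra.Fraction_Field"
    "HOL-Algebra.Ideal_Product"
    "HOL-Algebra.Generated_Rings"
    "HOL-Algebra.Algebraic_Closure_Type"
begin

text \<open>
  The polynomial ring in the variables indexed by the finite type \<open>'n\<close>, with coefficients in \<open>'k\<close>.
  A linear order on \<open>'n\<close> is needed only because \<^theory>\<open>HOL-Library.Poly_Mapping\<close> uses one to
  show that this ring is an integral domain.
\<close>

type_synonym ('n, 'k) mpoly = "('n \<Rightarrow>\<^sub>0 nat) \<Rightarrow>\<^sub>0 'k"

abbreviation mpoly_ring :: "('n, 'k::comm_ring_1) mpoly ring"
  where "mpoly_ring \<equiv> ring_of_type_algebra"


subsection \<open>Ideals in a commutative ring\<close>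

text \<open>
  The least number is taken over all finite generating sets, homogeneous or not; it is meaningful
  for finitely generated \<open>L\<close>, hence for every ideal of a polynomial ring over a field.
\<close>

definition min_num_gens :: "('a, 'b) ring_scheme \<Rightarrow> 'a set \<Rightarrow> nat"
  where "min_num_gens R L =
    (LEAST m. \<exists>S. S \<subseteq> carrier R \<and> finite S \<and> card S = m \<and> L = genideal R S)"

text \<open>
  The height of a prime is the supremum of the lengths of strict chains of primes ending in it; the
  unit ideal gets height \<open>\<infinity>\<close>.
\<close>

definition prime_height :: "('a, 'b) ring_scheme \<Rightarrow> 'a set \<Rightarrow> enat"
  where "prime_height R P =
    (SUP k \<in> {k. \<exists>C :: nat \<Rightarrow> 'a set.
        (\<forall>i\<le>k. primeideal (C i) R) \<and> (\<forall>i<k. C i \<subset> C (Suc i)) \<and> C k = P}. enat k)"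

definition ideal_height :: "('a, 'b) ring_scheme \<Rightarrow> 'a set \<Rightarrow> enat"
  where "ideal_height R L = (INF P \<in> {P. primeideal P R \<and> L \<subseteq> P}. prime_height R P)"


subsection \<open>The standard grading\<close>

definition total_degree :: "('n::finite \<Rightarrow>\<^sub>0 nat) \<Rightarrow> nat"
  where "total_degree m = (\<Sum>i\<in>UNIV. Poly_Mapping.lookup m i)"

text \<open>The zero polynomial is homogeneous of every degree.\<close>

definition homogeneous :: "nat \<Rightarrow> ('n::finite, 'k::zero) mpoly \<Rightarrow> bool"
  where "homogeneous d f \<longleftrightarrow> (\<forall>m\<in>Poly_Mapping.keys f. total_degree m = d)"

definition hom_component :: "nat \<Rightarrow> ('n::finite, 'k::comm_monoid_add) mpoly \<Rightarrow> ('n, 'k) mpoly"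
  where "hom_component d f =
    (\<Sum>m\<in>{m \<in> Poly_Mapping.keys f. total_degree m = d}. Poly_Mapping.single m (Poly_Mapping.lookup f m))"

definition graded_ideal :: "('n::finite, 'k::comm_ring_1) mpoly set \<Rightarrow> bool"
  where "graded_ideal L \<longleftrightarrow>
    ideal L mpoly_ring \<and> (\<forall>f\<in>L. \<forall>d. hom_component d f \<in> L)"

definition equigenerated :: "('n::finite, 'k::comm_ring_1) mpoly set \<Rightarrow> bool"
  where "equigenerated L \<longleftrightarrow>
    graded_ideal L \<and> (\<exists>d S. (\<forall>f\<in>S. homogeneous d f) \<and> L = genideal mpoly_ring S)"

definition Var :: "'n \<Rightarrow> ('n, 'k::comm_ring_1) mpoly"
  where "Var i = Poly_Mapping.single (Poly_Mapping.single i 1) 1"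

definition graded_max_ideal :: "('n, 'k::comm_ring_1) mpoly set"
  where "graded_max_ideal = genideal mpoly_ring (range Var)"


subsection \<open>Contracted ideals\<close>

definition to_fract :: "'a::idom \<Rightarrow> 'a fract"
  where "to_fract a = Fraction_Field.Fract a 1"

text \<open>The subring \<open>R[\<mm>/x]\<close> of the fraction field of \<open>R\<close>, where \<open>\<mm>\<close> is the graded maximal ideal.\<close>

definition blowup_ring ::
    "('n::{finite,linorder}, 'k::field) mpoly \<Rightarrow> ('n, 'k) mpoly fract ring"
  where "blowup_ring x = ring_of_type_algebra
    \<lparr>carrier := generate_ring ring_of_type_algebra
      (range to_fract \<union> {to_fract a / to_fract x | a. a \<in> graded_max_ideal})\<rparr>"

text \<open>
  The extension \<open>LT\<close> is the ideal of \<open>T = R[\<mm>/x]\<close> generated by the image of \<open>L\<close>;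
  \<open>LT \<inter> R\<close> is its preimage under the embedding of \<open>R\<close> in its fraction field.
\<close>

definition contracted :: "('n::{finite,linorder}, 'k::field) mpoly set \<Rightarrow> bool"
  where "contracted L \<longleftrightarrow>
    graded_ideal L \<and> L \<noteq> UNIV \<and>
    (\<exists>x \<in> graded_max_ideal - ideal_prod mpoly_ring graded_max_ideal graded_max_ideal.
       L = {a. to_fract a \<in> genideal (blowup_ring x) (to_fract ` L)})"

end

theory Submission
  imports Defs
begin

text \<open>
  An ideal \<open>L\<close> generated by forms of degree \<open>d\<close> is determined by the vector space \<open>L\<^sub>d\<close> of its
  forms of degree \<open>d\<close>, and \<open>\<mu>(L) = dim L\<^sub>d\<close> (\<open>min_num_gens_eq_dim\<close>). By Gaussian elimination the dimension
  of a space of polynomials is the number of leading monomials that occur in it (\<open>dim_eq_card_leads\<close>).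
  The leading monomial of a product is the product of the leading monomials, so the leading
  monomials of \<open>(A B)\<^sub>d\<^sub>+\<^sub>e\<close> contain the sumset of those of \<open>A\<^sub>d\<close> and of \<open>B\<^sub>e\<close>. In an ordered cancellative
  monoid a sumset \<open>X + Y\<close> has at least \<open>|X| + |Y| - 1\<close> elements (\<open>card_sumset_ge\<close>). Hence
  \<open>\<mu>(A B) \<ge> \<mu>(A) + \<mu>(B) - 1\<close> (\<open>min_num_gens_prod_ge\<close>), and both inequalities follow by induction on the
  number of factors, starting from the unit ideal, for which \<open>\<mu> = 1\<close>.

  In two variables there are \<open>d + 1\<close> monomials of degree \<open>d\<close>, so \<open>\<mu>(L) \<le> d + 1\<close> for every ideal generated
  in degree \<open>d\<close>. If \<open>L\<close> has height 2 and is contracted, this bound is attained, because \<open>L\<close> contains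
  every form of degree \<open>d\<close>. Indeed, height 2 forces \<open>\<mm>\<^sup>N \<subseteq> L\<close> for some \<open>N\<close>
  (\<open>order_ge_subset_if_height_2\<close>). Let \<open>T = R[\<mm>/x]\<close> witness that \<open>L\<close> is contracted and take \<open>M = N + d\<close>.
  The element \<open>x\<^sup>M\<close> is a combination of forms in \<open>L\<^sub>d\<close> with coefficients in \<open>\<mm>\<^sup>N\<close>; dividing by \<open>x\<^sup>N\<close>
  shows \<open>x\<^sup>d \<in> L T\<close>. A form \<open>f\<close> of degree \<open>d\<close> then satisfies \<open>f = (f/x\<^sup>d) x\<^sup>d \<in> L T \<inter> R = L\<close>
  (\<open>contracted_imp_order_ge_subset\<close>). The product of contracted ideals of degrees \<open>d\<^sub>j\<close> is generated in
  degree \<open>D = \<Sum> d\<^sub>j\<close>, so its \<open>\<mu>\<close> is at most \<open>D + 1\<close>, which is exactly the lower bound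
  \<open>\<Sum> (d\<^sub>j + 1) - (r - 1)\<close>.

  That height 2 forces \<open>\<mm>\<^sup>N \<subseteq> L\<close> is proved in the chart \<open>X \<mapsto> s, Y \<mapsto> t s\<close>, which turns a form of degree \<open>e\<close>
  into \<open>a(t) s\<^sup>e\<close>. The polynomials \<open>a\<close> that come from forms in \<open>L\<close> make up an ideal of the principal ideal
  domain \<open>K[t]\<close>. If it is the unit ideal, then a power of \<open>X\<close> lies in \<open>L\<close>. Otherwise a prime \<open>p\<close>
  divides all of it, so \<open>L\<close> lies in the principal prime ideal generated by the homogenization of \<open>p\<close>,
  and a nonzero principal prime ideal of a polynomial ring has height at most one.
\<close>

section \<open>Ideals as spans\<close>

text \<open>
  An ideal is a submodule of the ring over itself; this makes the calculus of linear spans available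
  for generated ideals.
\<close>

interpretation ideal_span: Modules.module "(*) :: 'a::comm_ring_1 \<Rightarrow> 'a \<Rightarrow> 'a"
  by unfold_locales (simp_all add: algebra_simps)

(* This rule reverses associativity of multiplication and loops when both are used for rewriting. *)
declare ideal_span.scale_scale [simp del]

lemma ring_of_type_algebra_simps [simp]:
  "carrier ring_of_type_algebra = UNIV"
  "x \<otimes>\<^bsub>ring_of_type_algebra\<^esub> y = x * y"
  "x \<oplus>\<^bsub>ring_of_type_algebra\<^esub> y = x + y"
  "\<one>\<^bsub>ring_of_type_algebra\<^esub> = 1"
  "\<zero>\<^bsub>ring_of_type_algebra\<^esub> = 0"
  by (simp_all add: ring_of_type_algebra_def)

lemma a_inv_ring_of_type_algebra [simp]:
  "\<ominus>\<^bsub>ring_of_type_algebra\<^esub> x = - (x :: 'a::comm_ring_1)"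
proof -
  interpret cring "ring_of_type_algebra :: 'a ring" by (rule cring_from_type_algebra)
  show ?thesis by (rule minus_equality) simp_all
qed

lemma ideal_iff_subspace:
  "ideal L (ring_of_type_algebra :: 'a::comm_ring_1 ring) \<longleftrightarrow> ideal_span.subspace L"
proof
  assume L: "ideal L (ring_of_type_algebra :: 'a ring)"
  show "ideal_span.subspace L"
    using additive_subgroup.zero_closed[OF ideal.axioms(1)[OF L]]
      additive_subgroup.a_closed[OF ideal.axioms(1)[OF L]] ideal.I_l_closed[OF L]
    by (auto simp: ideal_span.subspace_def)
next
  assume L: "ideal_span.subspace L"
  have neg: "- a \<in> L" if "a \<in> L" for a
    using ideal_span.subspace_scale[OF L that, of "-1"] by simp
  show "ideal L (ring_of_type_algebra :: 'a ring)"
  proof (rule idealI)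
    show "ring (ring_of_type_algebra :: 'a ring)" by (rule ring_from_type_algebra)
    show "subgroup L (add_monoid (ring_of_type_algebra :: 'a ring))"
    proof (rule subgroup.intro)
      fix x assume "x \<in> L"
      then show "inv\<^bsub>add_monoid ring_of_type_algebra\<^esub> x \<in> L"
        using neg by (simp only: a_inv_def[symmetric] a_inv_ring_of_type_algebra)
    qed (use L in \<open>auto simp: ideal_span.subspace_def\<close>)
    fix a x assume "a \<in> L"
    then have "x * a \<in> L" using L by (simp add: ideal_span.subspace_def)
    then show "x \<otimes>\<^bsub>ring_of_type_algebra\<^esub> a \<in> L" "a \<otimes>\<^bsub>ring_of_type_algebra\<^esub> x \<in> L"
      by (simp_all add: mult.commute)
  qed
qed

lemma genideal_eq_span:
  "genideal (ring_of_type_algebra :: 'a::comm_ring_1 ring) S = ideal_span.span S"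
  unfolding genideal_def ideal_iff_subspace
  using ideal_span.span_minimal[of S] ideal_span.subspace_span[of S] ideal_span.span_superset[of S]
  by blast

lemma ideal_prod_eq_span:
  assumes "ideal A (ring_of_type_algebra :: 'a::comm_ring_1 ring)"
    and "ideal B (ring_of_type_algebra :: 'a ring)"
  shows "ideal_prod ring_of_type_algebra A B = ideal_span.span {a * b | a b. a \<in> A \<and> b \<in> B}"
proof
  interpret cring "ring_of_type_algebra :: 'a ring" by (rule cring_from_type_algebra)
  show "ideal_prod ring_of_type_algebra A B \<subseteq> ideal_span.span {a * b | a b. a \<in> A \<and> b \<in> B}"
  proof
    fix f assume "f \<in> ideal_prod ring_of_type_algebra A B"
    then show "f \<in> ideal_span.span {a * b | a b. a \<in> A \<and> b \<in> B}"
      by induction (auto intro: ideal_span.span_base ideal_span.span_add)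
  qed
  have "a * b \<in> ideal_prod ring_of_type_algebra A B" if "a \<in> A" "b \<in> B" for a b
    using ideal_prod.prod[of a A b B ring_of_type_algebra] that by simp
  then show "ideal_span.span {a * b | a b. a \<in> A \<and> b \<in> B} \<subseteq> ideal_prod ring_of_type_algebra A B"
    using ideal_prod_is_ideal[OF assms] unfolding ideal_iff_subspace
    by (intro ideal_span.span_minimal) auto
qed

lemma span_combination:
  fixes x y :: "'a::comm_ring_1"
  assumes "x \<in> ideal_span.span P" and "y \<in> ideal_span.span P"
  shows "c * x + y \<in> ideal_span.span P"
  by (intro ideal_span.span_add ideal_span.span_scale assms)

lemma span_products_of_spans:
  fixes S T :: "'a::comm_ring_1 set"
  shows "ideal_span.span {a * b | a b. a \<in> ideal_span.span S \<and> b \<in> ideal_span.span T}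
    = ideal_span.span {a * b | a b. a \<in> S \<and> b \<in> T}" (is "_ = ?P")
proof
  have 1: "a * b \<in> ?P" if "a \<in> S" "b \<in> ideal_span.span T" for a b
    using that(2)
  proof (induction rule: ideal_span.span_induct_alt)
    case (step c x y)
    have "a * x \<in> ?P"
      using step(1) that(1) by (intro ideal_span.span_base) auto
    then have "c * (a * x) + a * y \<in> ?P"
      using step(2) by (rule span_combination)
    moreover have "a * (c * x + y) = c * (a * x) + a * y" by (simp add: algebra_simps)
    ultimately show ?case by (simp only:)
  qed (simp add: ideal_span.span_zero)
  have "a * b \<in> ?P" if "a \<in> ideal_span.span S" and b: "b \<in> ideal_span.span T" for a b
    using that(1)
  proof (induction rule: ideal_span.span_induct_alt)
    case (step c x y)
    have "c * (x * b) + y * b \<in> ?P"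
      using 1[OF step(1) b] step(2) by (rule span_combination)
    moreover have "(c * x + y) * b = c * (x * b) + y * b" by (simp add: algebra_simps)
    ultimately show ?case by (simp only:)
  qed (simp add: ideal_span.span_zero)
  then show "ideal_span.span {a * b | a b. a \<in> ideal_span.span S \<and> b \<in> ideal_span.span T} \<subseteq> ?P"
    by (intro ideal_span.span_minimal ideal_span.subspace_span) auto
  show "?P \<subseteq> ideal_span.span {a * b | a b. a \<in> ideal_span.span S \<and> b \<in> ideal_span.span T}"
    by (rule ideal_span.span_mono) (auto intro: ideal_span.span_base)
qed

section \<open>The standard grading\<close>

definition scalar_mult :: "'k::comm_ring_1 \<Rightarrow> ('n, 'k) mpoly \<Rightarrow> ('n, 'k) mpoly"
  where "scalar_mult c f = Poly_Mapping.single 0 c * f"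

interpretation lin: vector_space "scalar_mult :: 'k::field \<Rightarrow> ('n, 'k) mpoly \<Rightarrow> ('n, 'k) mpoly"
  by unfold_locales
    (simp_all add: scalar_mult_def algebra_simps single_add mult_single flip: mult.assoc)

lemma lookup_scalar_mult [simp]:
  "Poly_Mapping.lookup (scalar_mult c f) m = c * Poly_Mapping.lookup f m"
  by (simp add: scalar_mult_def flip: mult_map_scale_conv_mult) (simp add: map.rep_eq when_def)

lemma mpoly_eq_sum_single:
  "f = (\<Sum>m\<in>Poly_Mapping.keys f. Poly_Mapping.single m (Poly_Mapping.lookup f m))"
  by (rule poly_mapping_eqI) (auto simp: lookup_sum lookup_single when_def in_keys_iff)

lemma mpoly_induct [case_names single add]:
  fixes f :: "'m \<Rightarrow>\<^sub>0 'k::comm_monoid_add"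
  assumes single: "\<And>m c. P (Poly_Mapping.single m c)"
    and add: "\<And>f g. P f \<Longrightarrow> P g \<Longrightarrow> P (f + g)"
  shows "P f"
proof -
  have "P (\<Sum>m\<in>M. Poly_Mapping.single m (Poly_Mapping.lookup f m))" if "finite M" for M
    using that
  proof induction
    case empty
    show ?case using single[of undefined 0] by simp
  qed (auto intro: assms)
  then show ?thesis by (subst mpoly_eq_sum_single) simp
qed

lemma total_degree_zero [simp]: "total_degree 0 = 0"
  by (simp add: total_degree_def)

lemma total_degree_add [simp]: "total_degree (m + m') = total_degree m + total_degree m'"
  by (simp add: total_degree_def lookup_add sum.distrib)

lemma total_degree_eq_0_iff [simp]: "total_degree m = 0 \<longleftrightarrow> m = 0"
  by (auto simp: total_degree_def poly_mapping_eq_iff fun_eq_iff)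

lemma finite_monomials_of_degree: "finite {m :: 'n::finite \<Rightarrow>\<^sub>0 nat. total_degree m = d}"
proof (rule finite_imageD)
  have "Poly_Mapping.lookup m i \<le> total_degree m" for m :: "'n \<Rightarrow>\<^sub>0 nat" and i
    unfolding total_degree_def by (rule member_le_sum) auto
  then have "Poly_Mapping.lookup ` {m :: 'n \<Rightarrow>\<^sub>0 nat. total_degree m = d} \<subseteq> UNIV \<rightarrow>\<^sub>E {..d}"
    by auto
  then show "finite (Poly_Mapping.lookup ` {m :: 'n \<Rightarrow>\<^sub>0 nat. total_degree m = d})"
    by (rule finite_subset) (simp add: finite_PiE)
qed (simp add: inj_on_def poly_mapping.lookup_inject)

lemma lookup_hom_component [simp]:
  "Poly_Mapping.lookup (hom_component d f) m =
    (if total_degree m = d then Poly_Mapping.lookup f m else 0)"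
  by (auto simp: hom_component_def lookup_sum lookup_single when_def sum.delta' in_keys_iff)

lemma hom_component_add [simp]: "hom_component d (f + g) = hom_component d f + hom_component d g"
  by (rule poly_mapping_eqI) (simp add: lookup_add)

lemma hom_component_zero [simp]: "hom_component d 0 = 0"
  by (rule poly_mapping_eqI) simp

lemma homogeneous_iff: "homogeneous d f \<longleftrightarrow> (\<forall>m. Poly_Mapping.lookup f m \<noteq> 0 \<longrightarrow> total_degree m = d)"
  by (auto simp: homogeneous_def in_keys_iff)

lemma hom_component_homogeneous:
  "homogeneous d f \<Longrightarrow> hom_component e f = (if e = d then f else 0)"
  by (rule poly_mapping_eqI) (auto simp: homogeneous_iff)

lemma homogeneous_mult:
  fixes f g :: "('n::finite, 'k::comm_ring_1) mpoly"
  assumes "homogeneous d f" and "homogeneous e g"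
  shows "homogeneous (d + e) (f * g)"
  using keys_mult[of f g] assms by (fastforce simp: homogeneous_def)

lemma subspace_homogeneous: "lin.subspace {f. homogeneous d f}"
  by (auto simp: lin.subspace_def homogeneous_iff lookup_add) (metis add.left_neutral)

text \<open>This is the \<open>k\<close>-th power of the graded maximal ideal.\<close>

definition order_ge :: "nat \<Rightarrow> ('n::finite, 'k::zero) mpoly set"
  where "order_ge k = {f. \<forall>m. Poly_Mapping.lookup f m \<noteq> 0 \<longrightarrow> k \<le> total_degree m}"

lemma single_in_order_ge [simp]:
  "Poly_Mapping.single m c \<in> order_ge k \<longleftrightarrow> c = 0 \<or> k \<le> total_degree m"
  by (auto simp: order_ge_def lookup_single when_def)

lemma order_ge_0 [simp]: "order_ge 0 = UNIV"
  by (simp add: order_ge_def)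

lemma homogeneous_imp_order_ge: "homogeneous d f \<Longrightarrow> f \<in> order_ge d"
  by (auto simp: order_ge_def homogeneous_iff)

lemma order_ge_add: "f \<in> order_ge k \<Longrightarrow> g \<in> order_ge k \<Longrightarrow> f + g \<in> order_ge k"
  by (auto simp: order_ge_def lookup_add) (metis add.left_neutral)

lemma order_ge_mult:
  fixes f g :: "('n::finite, 'k::comm_ring_1) mpoly"
  assumes "f \<in> order_ge j" and "g \<in> order_ge k"
  shows "f * g \<in> order_ge (j + k)"
  unfolding order_ge_def
proof (intro CollectI allI impI)
  fix m assume "Poly_Mapping.lookup (f * g) m \<noteq> 0"
  then obtain a b where "m = a + b" "Poly_Mapping.lookup f a \<noteq> 0" "Poly_Mapping.lookup g b \<noteq> 0"
    using keys_mult[of f g] by (auto simp: in_keys_iff subset_iff)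
  then show "j + k \<le> total_degree m"
    using assms by (auto simp: order_ge_def intro: add_mono)
qed

lemma subspace_order_ge:
  "ideal_span.subspace (order_ge k :: ('n::finite, 'k::comm_ring_1) mpoly set)"
proof (rule ideal_span.subspaceI)
  show "c * f \<in> order_ge k" if "f \<in> order_ge k" for c f :: "('n, 'k) mpoly"
    using order_ge_mult[of c 0 f k] that by simp
  show "0 \<in> order_ge k" by (simp add: order_ge_def)
qed (rule order_ge_add)

lemma hom_component_eq_0_if_order_ge: "f \<in> order_ge k \<Longrightarrow> e < k \<Longrightarrow> hom_component e f = 0"
  by (rule poly_mapping_eqI) (auto simp: order_ge_def)

text \<open>
  Only the constant term of \<open>g\<close> contributes to the lowest degree of \<open>g f\<close>. This is why passing to the
  component of degree \<open>d\<close> turns ideal generators into spanning vectors over the field.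
\<close>

lemma hom_component_mult_lowest:
  fixes f g :: "('n::finite, 'k::comm_ring_1) mpoly"
  assumes "f \<in> order_ge d"
  shows "hom_component d (g * f) = scalar_mult (Poly_Mapping.lookup g 0) (hom_component d f)"
proof -
  define c :: "('n, 'k) mpoly" where "c = Poly_Mapping.single 0 (Poly_Mapping.lookup g 0)"
  have "g - c \<in> order_ge 1"
    by (auto simp: order_ge_def c_def lookup_minus lookup_single when_def Suc_le_eq intro!: gr0I)
  from order_ge_mult[OF this assms] have "hom_component d ((g - c) * f) = 0"
    by (rule hom_component_eq_0_if_order_ge) simp
  moreover have "hom_component d (g * f) = hom_component d ((g - c) * f) + hom_component d (c * f)"
    by (metis hom_component_add diff_add_cancel distrib_right)
  moreover have "hom_component d (c * f) = scalar_mult (Poly_Mapping.lookup g 0) (hom_component d f)"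
    unfolding c_def scalar_mult_def[symmetric] by (rule poly_mapping_eqI) simp
  ultimately show ?thesis by simp
qed

lemma mpoly_split_at_degree:
  fixes f :: "('n::finite, 'k::comm_ring_1) mpoly"
  obtains g h where "f = g + h" and "g \<in> order_ge k" and "\<And>m. Poly_Mapping.lookup h m \<noteq> 0 \<Longrightarrow> total_degree m < k"
proof -
  define h where "h = (\<Sum>d<k. hom_component d f)"
  have h: "Poly_Mapping.lookup h m = (if total_degree m < k then Poly_Mapping.lookup f m else 0)" for m
    by (simp add: h_def lookup_sum)
  show thesis
    by (rule that[of "f - h" h]) (auto simp: order_ge_def lookup_minus h split: if_splits)
qed

section \<open>Leading monomials\<close>

text \<open>
  The leading term with respect to the linear order on exponent vectors, which is compatible with
  addition. On the zero polynomial the value is arbitrary.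
\<close>

definition lead :: "('m::linorder \<Rightarrow>\<^sub>0 'k::zero) \<Rightarrow> 'm"
  where "lead f = Max (Poly_Mapping.keys f)"

definition leads :: "('m::linorder \<Rightarrow>\<^sub>0 'k::zero) set \<Rightarrow> 'm set"
  where "leads V = lead ` (V - {0})"

lemma lookup_lead_neq_0: "f \<noteq> 0 \<Longrightarrow> Poly_Mapping.lookup f (lead f) \<noteq> 0"
  unfolding lead_def using Max_in[of "Poly_Mapping.keys f"] by (auto simp: in_keys_iff)

lemma le_lead: "Poly_Mapping.lookup f m \<noteq> 0 \<Longrightarrow> m \<le> lead f"
  by (simp add: lead_def in_keys_iff)

lemma lead_eqI:
  "Poly_Mapping.lookup f m \<noteq> 0 \<Longrightarrow> (\<And>m'. Poly_Mapping.lookup f m' \<noteq> 0 \<Longrightarrow> m' \<le> m) \<Longrightarrow> lead f = m"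
  unfolding lead_def by (rule Max_eqI) (auto simp: in_keys_iff)

lemma lookup_mult_lead:
  fixes f g :: "'m::{linordered_cancel_ab_semigroup_add, comm_monoid_add} \<Rightarrow>\<^sub>0 'k::comm_ring_1"
  shows "Poly_Mapping.lookup (f * g) (lead f + lead g)
    = Poly_Mapping.lookup f (lead f) * Poly_Mapping.lookup g (lead g)"
proof -
  have eq: "a + b = lead f + lead g \<longleftrightarrow> a = lead f \<and> b = lead g"
    if "a \<in> Poly_Mapping.keys f" "b \<in> Poly_Mapping.keys g" for a b
  proof -
    have "a \<le> lead f" "b \<le> lead g" using that by (auto simp: lead_def)
    then show ?thesis
      using add_less_le_mono[of a "lead f" b "lead g"] add_le_less_mono[of a "lead f" b "lead g"]
      by (auto simp: order.order_iff_strict)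
  qed
  have "f * g = (\<Sum>a\<in>Poly_Mapping.keys f. Poly_Mapping.single a (Poly_Mapping.lookup f a))
      * (\<Sum>b\<in>Poly_Mapping.keys g. Poly_Mapping.single b (Poly_Mapping.lookup g b))"
    by (simp flip: mpoly_eq_sum_single)
  then have "Poly_Mapping.lookup (f * g) (lead f + lead g)
      = (\<Sum>a\<in>Poly_Mapping.keys f. \<Sum>b\<in>Poly_Mapping.keys g.
          Poly_Mapping.lookup f a * Poly_Mapping.lookup g b when a + b = lead f + lead g)"
    by (simp add: sum_product mult_single lookup_sum lookup_single)
  also have "\<dots> = (\<Sum>a\<in>Poly_Mapping.keys f. \<Sum>b\<in>Poly_Mapping.keys g.
      if b = lead g then if a = lead f then Poly_Mapping.lookup f a * Poly_Mapping.lookup g b else 0 else 0)"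
    by (intro sum.cong refl) (auto simp: eq when_def)
  also have "\<dots> = Poly_Mapping.lookup f (lead f) * Poly_Mapping.lookup g (lead g)"
    by (cases "Poly_Mapping.lookup g (lead g) = 0") (auto simp: in_keys_iff)
  finally show ?thesis .
qed

lemma lead_mult:
  fixes f g :: "'m::{linordered_cancel_ab_semigroup_add, comm_monoid_add} \<Rightarrow>\<^sub>0 'k::idom"
  assumes "f \<noteq> 0" and "g \<noteq> 0"
  shows "f * g \<noteq> 0" and "lead (f * g) = lead f + lead g"
proof -
  have nz: "Poly_Mapping.lookup (f * g) (lead f + lead g) \<noteq> 0"
    using assms by (simp add: lookup_mult_lead lookup_lead_neq_0)
  then show "f * g \<noteq> 0" by auto
  show "lead (f * g) = lead f + lead g"
  proof (rule lead_eqI[OF nz])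
    fix m assume "Poly_Mapping.lookup (f * g) m \<noteq> 0"
    then obtain a b where "m = a + b" "a \<in> Poly_Mapping.keys f" "b \<in> Poly_Mapping.keys g"
      using keys_mult[of f g] by (auto simp: in_keys_iff[symmetric] subset_iff)
    then show "m \<le> lead f + lead g" by (auto intro!: add_mono simp: lead_def)
  qed
qed

text \<open>
  The sums \<open>Min A + b\<close> and the sums \<open>a + Max B\<close> form two families of sizes \<open>|B|\<close> and \<open>|A|\<close> that share at
  most the element \<open>Min A + Max B\<close>.
\<close>

lemma card_sumset_ge:
  fixes A B :: "'a::linordered_cancel_ab_semigroup_add set"
  assumes "finite A" "A \<noteq> {}" "finite B" "B \<noteq> {}"
  shows "card A + card B \<le> Suc (card {a + b | a b. a \<in> A \<and> b \<in> B})"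
proof -
  let ?C = "(\<lambda>b. Min A + b) ` B" and ?D = "(\<lambda>a. a + Max B) ` A"
  have "?C \<inter> ?D \<subseteq> {Min A + Max B}"
  proof
    fix x assume "x \<in> ?C \<inter> ?D"
    then obtain a b where ab: "a \<in> A" "b \<in> B" "x = Min A + b" "x = a + Max B" by auto
    then have le: "Min A \<le> a" "b \<le> Max B" using assms by auto
    have "\<not> b < Max B"
      using add_le_less_mono[OF le(1), of b "Max B"] ab by auto
    then show "x \<in> {Min A + Max B}" using le ab by auto
  qed
  then have "card (?C \<inter> ?D) \<le> 1"
    using card_mono[of "{Min A + Max B}"] by fastforce
  moreover have "card ?C = card B" "card ?D = card A"
    by (auto intro!: card_image inj_onI)
  moreover have "card ?C + card ?D = card (?C \<union> ?D) + card (?C \<inter> ?D)"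
    using assms by (intro card_Un_Int) auto
  moreover have "card (?C \<union> ?D) \<le> card {a + b | a b. a \<in> A \<and> b \<in> B}"
  proof (rule card_mono)
    have "{a + b | a b. a \<in> A \<and> b \<in> B} = (\<lambda>(a, b). a + b) ` (A \<times> B)" by auto
    then show "finite {a + b | a b. a \<in> A \<and> b \<in> B}" using assms by simp
    show "?C \<union> ?D \<subseteq> {a + b | a b. a \<in> A \<and> b \<in> B}"
      using Min_in[OF assms(1,2)] Max_in[OF assms(3,4)] by blast
  qed
  ultimately show ?thesis by linarith
qed

text \<open>
  In a linear combination of polynomials with distinct leading monomials, the greatest leading
  monomial among those with nonzero coefficient cannot cancel.
\<close>

lemma independent_if_inj_on_lead:
  fixes B :: "('n::linorder, 'k::field) mpoly set"
  assumes "finite B" and "0 \<notin> B" and inj: "inj_on lead B"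
  shows "lin.independent B"
proof (rule lin.independent_if_scalars_zero[OF \<open>finite B\<close>], rule ccontr)
  fix u b0 assume sum0: "(\<Sum>b\<in>B. scalar_mult (u b) b) = 0" and b0: "b0 \<in> B" "u b0 \<noteq> 0"
  define N where "N = {b \<in> B. u b \<noteq> 0}"
  have N: "finite (lead ` N)" "lead ` N \<noteq> {}" using b0 \<open>finite B\<close> by (auto simp: N_def)
  then have "Max (lead ` N) \<in> lead ` N" by (rule Max_in)
  then obtain b where b: "b \<in> N" "lead b = Max (lead ` N)" by (metis imageE)
  have "u b' * Poly_Mapping.lookup b' (lead b) = (if b' = b then u b * Poly_Mapping.lookup b (lead b) else 0)"
    if "b' \<in> B" for b'
  proof -
    have "b' = b" if "b' \<in> N" "Poly_Mapping.lookup b' (lead b) \<noteq> 0"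
    proof -
      have "lead b' \<le> lead b" unfolding b(2) using N(1) that(1) by auto
      moreover have "lead b \<le> lead b'" using that(2) by (rule le_lead)
      ultimately show ?thesis using inj b(1) that(1) by (auto simp: inj_on_def N_def)
    qed
    then show ?thesis using that unfolding N_def by (cases "b' = b") auto
  qed
  then have "(\<Sum>b'\<in>B. u b' * Poly_Mapping.lookup b' (lead b))
      = (\<Sum>b'\<in>B. if b' = b then u b * Poly_Mapping.lookup b (lead b) else 0)"
    by (intro sum.cong refl)
  then have "(\<Sum>b'\<in>B. u b' * Poly_Mapping.lookup b' (lead b)) = u b * Poly_Mapping.lookup b (lead b)"
    using b(1) \<open>finite B\<close> by (simp add: N_def)
  moreover have "(\<Sum>b'\<in>B. u b' * Poly_Mapping.lookup b' (lead b)) = 0"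
    using arg_cong[OF sum0, of "\<lambda>f. Poly_Mapping.lookup f (lead b)"] by (simp add: lookup_sum)
  moreover have "b \<noteq> 0" "u b \<noteq> 0" using b \<open>0 \<notin> B\<close> by (auto simp: N_def)
  ultimately show False using lookup_lead_neq_0 by auto
qed

text \<open>
  Gaussian elimination: one polynomial of \<open>V\<close> chosen for each leading monomial gives a basis of \<open>V\<close>,
  since subtracting a multiple of the chosen polynomial lowers the leading monomial.
\<close>

lemma dim_eq_card_leads:
  fixes V :: "('n::linorder, 'k::field) mpoly set"
  assumes V: "lin.subspace V" and fin: "finite (leads V)"
  shows "lin.dim V = card (leads V)"
proof -
  have "\<forall>m\<in>leads V. \<exists>f. f \<in> V - {0} \<and> lead f = m" by (auto simp: leads_def)
  then obtain b where b: "\<And>m. m \<in> leads V \<Longrightarrow> b m \<in> V - {0} \<and> lead (b m) = m"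
    by metis
  \<comment> \<open>The two maps are mutually inverse, hence both injective.\<close>
  have inj: "inj_on lead (b ` leads V)" "inj_on b (leads V)"
    using b by (auto intro!: inj_onI) metis+
  have "v \<in> lin.span (b ` leads V)" if "v \<in> V" for v
    using that
  proof (induction "card {m \<in> leads V. m \<le> lead v}" arbitrary: v rule: less_induct)
    case less
    show ?case
    proof (cases "v = 0")
      case True
      then show ?thesis by (simp add: lin.span_zero)
    next
      case False
      define m where "m = lead v"
      have m: "m \<in> leads V" using False less.prems by (auto simp: m_def leads_def)
      define c where "c = Poly_Mapping.lookup v m / Poly_Mapping.lookup (b m) m"
      define w where "w = v - scalar_mult c (b m)"
      have bm: "b m \<in> V" "lead (b m) = m" "Poly_Mapping.lookup (b m) m \<noteq> 0"
        using b[OF m] lookup_lead_neq_0[of "b m"] by auto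
      have "w \<in> V"
        unfolding w_def by (intro lin.subspace_diff lin.subspace_scale V bm less.prems)
      have wm: "Poly_Mapping.lookup w m = 0" using bm by (simp add: w_def c_def lookup_minus)
      have wle: "m' \<le> m" if "Poly_Mapping.lookup w m' \<noteq> 0" for m'
      proof -
        have "Poly_Mapping.lookup v m' \<noteq> 0 \<or> Poly_Mapping.lookup (b m) m' \<noteq> 0"
          using that by (auto simp: w_def lookup_minus)
        then show ?thesis using le_lead[of v m'] le_lead[of "b m" m'] bm(2) by (auto simp: m_def)
      qed
      have "w \<in> lin.span (b ` leads V)"
      proof (cases "w = 0")
        case False
        then have "lead w < m"
          using wm wle lookup_lead_neq_0[OF False] by (metis order.not_eq_order_implies_strict)
        then have "{m' \<in> leads V. m' \<le> lead w} \<subset> {m' \<in> leads V. m' \<le> lead v}"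
          using m unfolding m_def by (fastforce dest: leD)
        then show ?thesis
          using less.hyps[OF _ \<open>w \<in> V\<close>] fin by (simp add: psubset_card_mono)
      qed (simp add: lin.span_zero)
      moreover have "b m \<in> lin.span (b ` leads V)" using m by (intro lin.span_base) auto
      moreover have "v = w + scalar_mult c (b m)" by (simp add: w_def)
      ultimately show ?thesis by (metis lin.span_add lin.span_scale)
    qed
  qed
  then show ?thesis
    using b inj fin
    by (intro lin.dim_unique[of "b ` leads V"] independent_if_inj_on_lead) (auto simp: card_image)
qed

section \<open>Ideals generated in one degree\<close>

definition generated_in_degree :: "nat \<Rightarrow> ('n::finite, 'k::comm_ring_1) mpoly set \<Rightarrow> bool"
  where "generated_in_degree d L \<longleftrightarrow> (\<exists>S. (\<forall>f\<in>S. homogeneous d f) \<and> L = ideal_span.span S)"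

definition degree_part :: "nat \<Rightarrow> ('n::finite, 'k::zero) mpoly set \<Rightarrow> ('n, 'k) mpoly set"
  where "degree_part d L = {f \<in> L. homogeneous d f}"

lemma equigenerated_imp_generated_in_degree:
  "equigenerated L \<Longrightarrow> \<exists>d. generated_in_degree d L"
  by (auto simp: equigenerated_def generated_in_degree_def genideal_eq_span)

lemma generated_in_degree_imp_ideal: "generated_in_degree d L \<Longrightarrow> ideal L mpoly_ring"
  by (auto simp: generated_in_degree_def ideal_iff_subspace)

lemma generated_in_degree_subset_order_ge:
  assumes "generated_in_degree d L"
  shows "L \<subseteq> order_ge d"
proof -
  obtain S where "\<forall>f\<in>S. homogeneous d f" "L = ideal_span.span S"
    using assms by (auto simp: generated_in_degree_def)
  then show ?thesis
    using ideal_span.span_minimal[OF _ subspace_order_ge, of S d] homogeneous_imp_order_ge by blast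
qed

lemma span_degree_part:
  assumes "generated_in_degree d L"
  shows "ideal_span.span (degree_part d L) = L"
proof -
  obtain S where S: "\<forall>f\<in>S. homogeneous d f" "L = ideal_span.span S"
    using assms by (auto simp: generated_in_degree_def)
  have "S \<subseteq> degree_part d L"
    using S by (auto simp: degree_part_def intro: ideal_span.span_base)
  then have "L \<subseteq> ideal_span.span (degree_part d L)" unfolding S(2) by (rule ideal_span.span_mono)
  moreover have "ideal_span.span (degree_part d L) \<subseteq> L"
    unfolding S(2) by (intro ideal_span.span_minimal) (auto simp: degree_part_def)
  ultimately show ?thesis by simp
qed

lemma subspace_degree_part:
  fixes L :: "('n::finite, 'k::field) mpoly set"
  assumes "ideal L mpoly_ring"
  shows "lin.subspace (degree_part d L)"
  using assms subspace_homogeneous[of d]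
  by (auto simp: lin.subspace_def degree_part_def ideal_iff_subspace ideal_span.subspace_def scalar_mult_def)

lemma finite_leads_degree_part: "finite (leads (degree_part d (L :: ('n::{finite,linorder}, 'k::field) mpoly set)))"
proof (rule finite_subset[OF _ finite_monomials_of_degree[of d]])
  show "leads (degree_part d L) \<subseteq> {m. total_degree m = d}"
    using lookup_lead_neq_0 by (auto simp: leads_def degree_part_def homogeneous_iff)
qed

text \<open>
  A basis of \<open>L\<^sub>d\<close> generates \<open>L\<close>. Conversely, \<open>L\<close> has no elements of order below \<open>d\<close>, so by
  \<open>hom_component_mult_lowest\<close> the components of degree \<open>d\<close> of any generating set, homogeneous or not, span
  \<open>L\<^sub>d\<close>.
\<close>

lemma min_num_gens_eq_dim:
  fixes L :: "('n::{finite,linorder}, 'k::field) mpoly set"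
  assumes L: "generated_in_degree d L"
  shows "min_num_gens mpoly_ring L = lin.dim (degree_part d L)"
  unfolding min_num_gens_def genideal_eq_span
proof (rule Least_equality)
  have id: "ideal_span.subspace L"
    using L generated_in_degree_imp_ideal ideal_iff_subspace by blast
  obtain B where B: "B \<subseteq> degree_part d L" "lin.independent B" "degree_part d L \<subseteq> lin.span B"
    "card B = lin.dim (degree_part d L)"
    using lin.basis_exists by blast
  have "finite B"
  proof -
    let ?M = "(\<lambda>m. Poly_Mapping.single m (1::'k)) ` {m :: 'n \<Rightarrow>\<^sub>0 nat. total_degree m = d}"
    have "f \<in> lin.span ?M" if "homogeneous d f" for f
    proof -
      have "(\<Sum>m\<in>Poly_Mapping.keys f. scalar_mult (Poly_Mapping.lookup f m) (Poly_Mapping.single m 1)) \<in> lin.span ?M"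
        using that by (intro lin.span_sum lin.span_scale lin.span_base) (auto simp: homogeneous_def)
      then show ?thesis
        by (simp add: scalar_mult_def mult_single flip: mpoly_eq_sum_single)
    qed
    then show ?thesis
      using lin.independent_span_bound[of ?M B] B(1,2) finite_monomials_of_degree[of d, where 'n='n]
      by (auto simp: degree_part_def subset_iff)
  qed
  moreover have "L = ideal_span.span B"
  proof
    have "lin.span B \<subseteq> ideal_span.span B"
      using ideal_span.subspace_span[of B]
      by (intro lin.span_minimal ideal_span.span_superset)
        (auto simp: lin.subspace_def ideal_span.subspace_def scalar_mult_def)
    then have "ideal_span.span (degree_part d L) \<subseteq> ideal_span.span B"
      using B(3) by (intro ideal_span.span_minimal) auto
    then show "L \<subseteq> ideal_span.span B" using span_degree_part[OF L] by simp
    show "ideal_span.span B \<subseteq> L"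
      using B(1) id by (intro ideal_span.span_minimal) (auto simp: degree_part_def)
  qed
  ultimately show "\<exists>S\<subseteq>carrier (mpoly_ring :: ('n, 'k) mpoly ring). finite S \<and>
      card S = lin.dim (degree_part d L) \<and> L = ideal_span.span S"
    using B(4) by auto
next
  fix k assume "\<exists>S\<subseteq>carrier (mpoly_ring :: ('n, 'k) mpoly ring). finite S \<and> card S = k \<and> L = ideal_span.span S"
  then obtain S where S: "finite S" "card S = k" "L = ideal_span.span S" by auto
  have SL: "S \<subseteq> L" using S ideal_span.span_superset by blast
  have "hom_component d f \<in> lin.span (hom_component d ` S)" if "f \<in> L" for f
    using that unfolding S(3)
  proof (induction rule: ideal_span.span_induct_alt)
    case base
    show ?case by (simp add: lin.span_zero)
  next
    case (step c x y)
    have "x \<in> order_ge d" using step SL generated_in_degree_subset_order_ge[OF L] by auto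
    then have "hom_component d (c * x) = scalar_mult (Poly_Mapping.lookup c 0) (hom_component d x)"
      by (rule hom_component_mult_lowest)
    then show ?case
      using step by (simp add: lin.span_add lin.span_scale lin.span_base)
  qed
  then have "degree_part d L \<subseteq> lin.span (hom_component d ` S)"
    by (fastforce simp: degree_part_def hom_component_homogeneous)
  then have "lin.dim (degree_part d L) \<le> card (hom_component d ` S)"
    by (rule lin.dim_le_card) (simp add: S)
  also have "\<dots> \<le> k" using S card_image_le by blast
  finally show "lin.dim (degree_part d L) \<le> k" .
qed

lemma min_num_gens_eq_card_leads:
  fixes L :: "('n::{finite,linorder}, 'k::field) mpoly set"
  assumes L: "generated_in_degree d L"
  shows "min_num_gens mpoly_ring L = card (leads (degree_part d L))"
  using min_num_gens_eq_dim[OF L] generated_in_degree_imp_ideal[OF L]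
  by (simp add: dim_eq_card_leads subspace_degree_part finite_leads_degree_part)

lemma leads_degree_part_nonempty:
  assumes "generated_in_degree d L" and "L \<noteq> {0}"
  shows "leads (degree_part d L) \<noteq> {}"
  using span_degree_part[OF assms(1)] assms(2) ideal_span.span_minimal[of "degree_part d L" "{0}"]
    ideal_span.span_zero[of "degree_part d L"]
  by (auto simp: leads_def)

section \<open>Products of two ideals\<close>

lemma generated_in_degree_prod:
  fixes A B :: "('n::finite, 'k::comm_ring_1) mpoly set"
  assumes "generated_in_degree d A" and "generated_in_degree e B"
  shows "generated_in_degree (d + e) (ideal_prod mpoly_ring A B)"
proof -
  obtain S T where S: "\<forall>f\<in>S. homogeneous d f" "A = ideal_span.span S"
    and T: "\<forall>f\<in>T. homogeneous e f" "B = ideal_span.span T"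
    using assms by (auto simp: generated_in_degree_def)
  have "ideal_prod mpoly_ring A B = ideal_span.span {a * b | a b. a \<in> S \<and> b \<in> T}"
    using assms by (simp add: ideal_prod_eq_span generated_in_degree_imp_ideal S T span_products_of_spans)
  then show ?thesis
    using S T unfolding generated_in_degree_def
    by (intro exI[of _ "{a * b | a b. a \<in> S \<and> b \<in> T}"]) (auto intro: homogeneous_mult)
qed

lemma mult_in_ideal_prod: "a \<in> A \<Longrightarrow> b \<in> B \<Longrightarrow> a * b \<in> ideal_prod ring_of_type_algebra A B"
  using ideal_prod.prod[of a A b B ring_of_type_algebra] by simp

lemma ideal_prod_neq_zero:
  fixes A B :: "'a::idom set"
  assumes "ideal A ring_of_type_algebra" "ideal B ring_of_type_algebra" "A \<noteq> {0}" "B \<noteq> {0}"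
  shows "ideal_prod ring_of_type_algebra A B \<noteq> {0}"
proof -
  have "0 \<in> A" "0 \<in> B"
    using assms(1,2) by (auto simp: ideal_iff_subspace ideal_span.subspace_0)
  obtain a where a: "a \<in> A" "a \<noteq> 0" using \<open>0 \<in> A\<close> \<open>A \<noteq> {0}\<close> by blast
  obtain b where b: "b \<in> B" "b \<noteq> 0" using \<open>0 \<in> B\<close> \<open>B \<noteq> {0}\<close> by blast
  have "a * b \<in> ideal_prod ring_of_type_algebra A B" using a b by (intro mult_in_ideal_prod)
  moreover have "a * b \<noteq> 0" using a b by simp
  ultimately show ?thesis by blast
qed

text \<open>
  Products of elements of \<open>A\<^sub>d\<close> and \<open>B\<^sub>e\<close> realize the whole sumset of the two sets of leading monomials.
\<close>

lemma min_num_gens_prod_ge: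
  fixes A B :: "('n::{finite,linorder}, 'k::field) mpoly set"
  assumes A: "generated_in_degree d A" "A \<noteq> {0}" and B: "generated_in_degree e B" "B \<noteq> {0}"
  shows "min_num_gens mpoly_ring A + min_num_gens mpoly_ring B
    \<le> Suc (min_num_gens mpoly_ring (ideal_prod mpoly_ring A B))"
proof -
  let ?A = "leads (degree_part d A)" and ?B = "leads (degree_part e B)"
    and ?C = "leads (degree_part (d + e) (ideal_prod mpoly_ring A B))"
  have "card ?A + card ?B \<le> Suc (card {a + b | a b. a \<in> ?A \<and> b \<in> ?B})"
    using A B by (intro card_sumset_ge finite_leads_degree_part leads_degree_part_nonempty)
  also have "card {a + b | a b. a \<in> ?A \<and> b \<in> ?B} \<le> card ?C"
  proof (intro card_mono finite_leads_degree_part subsetI)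
    fix m assume "m \<in> {a + b | a b. a \<in> ?A \<and> b \<in> ?B}"
    then obtain f g where fg: "f \<in> degree_part d A - {0}" "g \<in> degree_part e B - {0}" "m = lead f + lead g"
      by (auto simp: leads_def)
    then have "f * g \<in> degree_part (d + e) (ideal_prod mpoly_ring A B) - {0}" "lead (f * g) = m"
      by (auto simp: degree_part_def lead_mult homogeneous_mult mult_in_ideal_prod)
    then show "m \<in> ?C" by (force simp: leads_def)
  qed
  finally show ?thesis
    by (simp add: min_num_gens_eq_card_leads[OF A(1)] min_num_gens_eq_card_leads[OF B(1)]
        min_num_gens_eq_card_leads[OF generated_in_degree_prod[OF A(1) B(1)]])
qed

lemma generated_in_degree_UNIV: "generated_in_degree 0 (UNIV :: ('n::finite, 'k::comm_ring_1) mpoly set)"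
  unfolding generated_in_degree_def
proof (intro exI[of _ "{1}"] conjI)
  show "UNIV = ideal_span.span {1 :: ('n, 'k) mpoly}" by (auto simp: ideal_span.span_singleton)
qed (auto simp: homogeneous_def)

section \<open>Two variables: the affine chart of the blow-up\<close>

text \<open>
  The ring homomorphism that sends the variable \<open>j\<close> to \<open>t s\<close> and every other variable to \<open>s\<close>, where \<open>t\<close> is
  the inner and \<open>s\<close> the outer polynomial variable. The exponent of \<open>s\<close> thus records the total degree;
  in two variables the coefficient of \<open>s\<^sup>e\<close> is the dehomogenization of the component of degree \<open>e\<close>.
\<close>

definition chart :: "'n \<Rightarrow> ('n::finite, 'k::field) mpoly \<Rightarrow> 'k poly poly"
  where "chart j f = (\<Sum>m\<in>Poly_Mapping.keys f.
    Polynomial.monom (Polynomial.monom (Poly_Mapping.lookup f m) (Poly_Mapping.lookup m j)) (total_degree m))"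

lemma chart_eq_sum_superset:
  assumes "finite M" and "Poly_Mapping.keys f \<subseteq> M"
  shows "chart j f = (\<Sum>m\<in>M.
    Polynomial.monom (Polynomial.monom (Poly_Mapping.lookup f m) (Poly_Mapping.lookup m j)) (total_degree m))"
  unfolding chart_def using assms by (intro sum.mono_neutral_left) (auto simp: in_keys_iff)

lemma chart_zero [simp]: "chart j 0 = 0"
  by (simp add: chart_def)

lemma chart_single [simp]:
  "chart j (Poly_Mapping.single m c) = Polynomial.monom (Polynomial.monom c (Poly_Mapping.lookup m j)) (total_degree m)"
  by (simp add: chart_def)

lemma chart_one [simp]: "chart j 1 = 1"
  using chart_single[of j 0 1] by (simp add: monom_eq_1)

lemma chart_add [simp]: "chart j (f + g) = chart j f + chart j g"
proof -
  let ?M = "Poly_Mapping.keys f \<union> Poly_Mapping.keys g"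
  show ?thesis
    using keys_add[of f g]
    by (simp add: chart_eq_sum_superset[of ?M] lookup_add sum.distrib flip: add_monom)
qed

lemma chart_sum: "chart j (sum f A) = (\<Sum>a\<in>A. chart j (f a))"
  by (induction A rule: infinite_finite_induct) simp_all

lemma chart_mult [simp]: "chart j (f * g) = chart j f * chart j g"
proof (induction f rule: mpoly_induct)
  case (single m c)
  show ?case
    by (induction g rule: mpoly_induct)
      (simp_all add: mult_single mult_monom lookup_add distrib_left)
qed (simp add: distrib_right)

lemma chart_homogeneous:
  assumes "homogeneous d f"
  shows "chart j f = Polynomial.monom (Polynomial.coeff (chart j f) d) d"
proof (rule poly_eqI)
  fix e
  show "Polynomial.coeff (chart j f) e = Polynomial.coeff (Polynomial.monom (Polynomial.coeff (chart j f) d) d) e"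
    using assms by (auto simp: chart_def coeff_sum homogeneous_def intro!: sum.neutral)
qed

lemma degree_coeff_chart_le:
  fixes f :: "('n::finite, 'k::field) mpoly"
  shows "Polynomial.degree (Polynomial.coeff (chart j f) e) \<le> e"
proof (rule degree_le, intro allI impI)
  fix b assume "e < b"
  have "Poly_Mapping.lookup m j \<le> total_degree m" for m :: "'n \<Rightarrow>\<^sub>0 nat"
    unfolding total_degree_def by (rule member_le_sum) auto
  then show "Polynomial.coeff (Polynomial.coeff (chart j f) e) b = 0"
    using \<open>e < b\<close> by (auto simp: chart_def coeff_sum intro!: sum.neutral) (metis leD)
qed

lemma total_degree_single [simp]: "total_degree (Poly_Mapping.single i a) = a"
  by (simp add: total_degree_def lookup_single when_def)

text \<open>
  For two variables and irreducible \<open>p\<close>, these are the polynomials vanishing on the lines through the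
  origin whose slope is a root of \<open>p\<close> in an algebraic closure.
\<close>

definition chart_prime :: "'n \<Rightarrow> 'k::field poly \<Rightarrow> ('n::finite, 'k) mpoly set"
  where "chart_prime j p = {f. [:p:] dvd chart j f}"

text \<open>
  A prime element of \<open>K[t]\<close> stays prime in \<open>K[t][s]\<close>, and the preimage of a prime ideal is prime.
\<close>

lemma primeideal_chart_prime:
  fixes p :: "'k::field poly"
  assumes p: "prime_elem p"
  shows "primeideal (chart_prime j p :: ('n::finite, 'k) mpoly set) mpoly_ring"
proof (rule primeidealI)
  have pp: "prime_elem [:p:]" using p by (simp add: prime_elem_const_poly_iff)
  show "ideal (chart_prime j p) mpoly_ring"
    by (auto simp: ideal_iff_subspace ideal_span.subspace_def chart_prime_def)
  show "cring (mpoly_ring :: ('n, 'k) mpoly ring)" by (rule cring_from_type_algebra)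
  have "1 \<notin> (chart_prime j p :: ('n, 'k) mpoly set)" using pp by (auto simp: chart_prime_def prime_elem_def)
  then show "carrier (mpoly_ring :: ('n, 'k) mpoly ring) \<noteq> chart_prime j p" by auto
  show "a \<in> chart_prime j p \<or> b \<in> chart_prime j p" if "a \<otimes>\<^bsub>mpoly_ring\<^esub> b \<in> chart_prime j p" for a b :: "('n, 'k) mpoly"
    using that pp by (simp add: chart_prime_def prime_elem_dvd_mult_iff)
qed

lemma irreducible_factor_exists:
  fixes g :: "'k::field poly"
  assumes "Polynomial.degree g > 0"
  obtains p where "irreducible p" and "p dvd g"
proof -
  have "\<exists>p. irreducible p \<and> p dvd g"
    using assms
  proof (induction "Polynomial.degree g" arbitrary: g rule: less_induct)
    case less
    show ?case
    proof (cases "irreducible g")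
      case False
      have "g \<noteq> 0" using less.prems by auto
      then have "\<not> is_unit g" using less.prems by (simp add: is_unit_iff_degree)
      with False \<open>g \<noteq> 0\<close> obtain a b where ab: "g = a * b" "\<not> is_unit a" "\<not> is_unit b"
        by (auto simp: irreducible_def)
      with \<open>g \<noteq> 0\<close> have "a \<noteq> 0" "b \<noteq> 0" by auto
      with ab have "Polynomial.degree a > 0" "Polynomial.degree a < Polynomial.degree g"
        by (auto simp: is_unit_iff_degree degree_mult_eq)
      then show ?thesis using less.hyps[of a] ab(1) dvd_mult2 by blast
    qed auto
  qed
  then show thesis using that by blast
qed

text \<open>
  The ideals of \<open>K[t]\<close> are principal: an element of least degree generates, by division with remainder.
\<close>

lemma poly_ideal_proper_imp_common_prime_factor:
  fixes J :: "'k::field poly set"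
  assumes J: "ideal_span.subspace J" and "1 \<notin> J"
  obtains p where "prime_elem p" and "\<And>a. a \<in> J \<Longrightarrow> p dvd a"
proof (cases "J \<subseteq> {0}")
  case True
  \<comment> \<open>The zero ideal is divisible by every prime element; \<open>t\<close> is one.\<close>
  have "prime_elem ([:0, 1:] :: 'k poly)"
    by (rule prime_elem_linear_field_poly) simp
  then show thesis using True that by fastforce
next
  case False
  then obtain g where g: "g \<in> J" "g \<noteq> 0"
    and min: "\<And>a. a \<in> J \<Longrightarrow> a \<noteq> 0 \<Longrightarrow> Polynomial.degree g \<le> Polynomial.degree a"
    using arg_min_nat_lemma[of "\<lambda>a. a \<in> J \<and> a \<noteq> 0" _ Polynomial.degree] by blast
  have dvd: "g dvd a" if "a \<in> J" for a
  proof -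
    have "a + (- (a div g)) * g \<in> J"
      using J that g by (intro ideal_span.subspace_add ideal_span.subspace_scale)
    then have "a mod g \<in> J"
      by (simp add: minus_div_mult_eq_mod)
    then have "a mod g = 0"
      using min[of "a mod g"] degree_mod_less[OF g(2), of a] by force
    then show ?thesis by (simp add: dvd_eq_mod_eq_0)
  qed
  have "Polynomial.degree g > 0"
  proof (rule ccontr)
    assume "\<not> Polynomial.degree g > 0"
    then have "is_unit g" using g(2) by (simp add: is_unit_iff_degree)
    then obtain h where "1 = g * h" by (elim dvdE)
    then have "1 = h * g" by (simp add: mult.commute)
    then show False using ideal_span.subspace_scale[OF J g(1), of h] \<open>1 \<notin> J\<close> by simp
  qed
  then obtain p where "irreducible p" "p dvd g" by (rule irreducible_factor_exists)
  then show thesis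
    using that[of p] dvd field_poly_irreducible_imp_prime dvd_trans by blast
qed

context
  fixes i j :: "'n::{finite,linorder}"
  assumes two_vars: "(UNIV :: 'n set) = {i, j}" and neq: "i \<noteq> j"
begin

lemma total_degree_two: "total_degree m = Poly_Mapping.lookup m i + Poly_Mapping.lookup m j"
  using neq by (simp add: total_degree_def two_vars)

lemma monomial_eq_iff_two:
  "m = m' \<longleftrightarrow> total_degree m = total_degree m' \<and> Poly_Mapping.lookup m j = Poly_Mapping.lookup m' j"
proof
  assume eq: "total_degree m = total_degree m' \<and> Poly_Mapping.lookup m j = Poly_Mapping.lookup m' j"
  show "m = m'"
  proof (rule poly_mapping_eqI)
    fix k
    have "k = i \<or> k = j" using two_vars by blast
    then show "Poly_Mapping.lookup m k = Poly_Mapping.lookup m' k"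
      using eq by (auto simp: total_degree_two)
  qed
qed auto

lemma card_monomials_of_degree_two: "card {m :: 'n \<Rightarrow>\<^sub>0 nat. total_degree m = d} = d + 1"
proof -
  have "bij_betw (\<lambda>m. Poly_Mapping.lookup m j) {m. total_degree m = d} {..d}"
  proof (rule bij_betwI')
    fix b assume "b \<in> {..d}"
    then show "\<exists>m\<in>{m. total_degree m = d}. b = Poly_Mapping.lookup m j"
      using neq
      by (intro bexI[of _ "Poly_Mapping.single i (d - b) + Poly_Mapping.single j b"])
        (auto simp: lookup_add lookup_single when_def)
  qed (auto simp: monomial_eq_iff_two, simp add: total_degree_two)
  then show ?thesis by (auto dest: bij_betw_same_card)
qed

lemma coeff_coeff_chart:
  "Polynomial.coeff (Polynomial.coeff (chart j f) (total_degree m)) (Poly_Mapping.lookup m j) = Poly_Mapping.lookup f m"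
proof -
  have "Polynomial.coeff (Polynomial.coeff (chart j f) (total_degree m)) (Poly_Mapping.lookup m j)
      = (\<Sum>m'\<in>Poly_Mapping.keys f. if m' = m then Poly_Mapping.lookup f m' else 0)"
    unfolding chart_def coeff_sum by (intro sum.cong refl) (auto simp: monomial_eq_iff_two)
  then show ?thesis by (simp add: in_keys_iff)
qed

lemma chart_inject: "chart j f = chart j g \<longleftrightarrow> f = g"
  by (metis coeff_coeff_chart poly_mapping_eqI)

text \<open>
  Together with \<open>degree_coeff_chart_le\<close> this identifies the image of the chart: a coefficient of \<open>s\<^sup>e\<close> of
  degree at most \<open>e\<close> can be homogenized in degree \<open>e\<close>.
\<close>

lemma chart_image:
  assumes "\<And>e. Polynomial.degree (Polynomial.coeff F e) \<le> e"
  obtains f where "chart j f = F"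
proof -
  define f where "f = (\<Sum>e\<le>Polynomial.degree F. \<Sum>b\<le>e.
    Poly_Mapping.single (Poly_Mapping.single i (e - b) + Poly_Mapping.single j b) (Polynomial.coeff (Polynomial.coeff F e) b))"
  have "chart j f = (\<Sum>e\<le>Polynomial.degree F. \<Sum>b\<le>e.
      Polynomial.monom (Polynomial.monom (Polynomial.coeff (Polynomial.coeff F e) b) b) e)"
    using neq unfolding f_def chart_sum
    by (intro sum.cong refl) (auto simp: lookup_add lookup_single)
  also have "\<dots> = (\<Sum>e\<le>Polynomial.degree F. Polynomial.monom (Polynomial.coeff F e) e)"
  proof (intro sum.cong refl)
    fix e
    have "(\<Sum>b\<le>e. Polynomial.monom (Polynomial.monom (Polynomial.coeff (Polynomial.coeff F e) b) b) e)
      = Polynomial.monom (\<Sum>b\<le>e. Polynomial.monom (Polynomial.coeff (Polynomial.coeff F e) b) b) e"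
      by (rule poly_eqI) (simp add: coeff_sum)
    then show "(\<Sum>b\<le>e. Polynomial.monom (Polynomial.monom (Polynomial.coeff (Polynomial.coeff F e) b) b) e)
      = Polynomial.monom (Polynomial.coeff F e) e"
      using assms[of e] by (simp add: poly_as_sum_of_monoms')
  qed
  also have "\<dots> = F" by (rule poly_as_sum_of_monoms)
  finally show thesis by (rule that)
qed

lemma chart_monom_image:
  assumes "Polynomial.degree a \<le> N"
  obtains f where "chart j f = Polynomial.monom a N"
  using assms by (auto intro: chart_image[of "Polynomial.monom a N"])

lemma chart_Var_power: "chart j (Var i ^ N :: ('n, 'k::field) mpoly) = Polynomial.monom 1 N"
proof (induction N)
  case (Suc N)
  have "chart j (Var i :: ('n, 'k) mpoly) = Polynomial.monom 1 1"
    using neq by (simp add: Var_def lookup_single monom_eq_1)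
  then show ?case using Suc by (simp add: mult_monom)
qed (simp add: monom_eq_1)

text \<open>
  The generator is the homogenization of \<open>p\<close>. If \<open>p\<close> divides the chart image of \<open>f\<close>, the degree bounds on
  the coefficients show that the quotient is divisible by \<open>s\<close> to the power \<open>deg p\<close> and that what remains is
  again a chart image.
\<close>

lemma chart_prime_principal:
  fixes p :: "'k::field poly"
  assumes p: "prime_elem p"
  shows "\<exists>h. chart j h = Polynomial.monom p (Polynomial.degree p) \<and> (\<forall>f\<in>chart_prime j p. h dvd f)"
proof -
  obtain h where h: "chart j h = Polynomial.monom p (Polynomial.degree p)"
    by (rule chart_monom_image[OF order_refl])
  have "h dvd f" if f: "f \<in> chart_prime j p" for f
  proof -
    obtain q where q: "chart j f = [:p:] * q"
      using f unfolding chart_prime_def mem_Collect_eq by (rule dvdE)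
    have deg: "Polynomial.coeff q e = 0 \<or> Polynomial.degree p + Polynomial.degree (Polynomial.coeff q e) \<le> e" for e
      using degree_coeff_chart_le[of j f e] p
      by (cases "Polynomial.coeff q e = 0") (auto simp: q degree_mult_eq prime_elem_def)
    obtain g where g: "chart j g = poly_shift (Polynomial.degree p) q"
    proof (rule chart_image)
      fix e
      show "Polynomial.degree (Polynomial.coeff (poly_shift (Polynomial.degree p) q) e) \<le> e"
        using deg[of "e + Polynomial.degree p"] by (auto simp: coeff_poly_shift)
    qed
    have "chart j f = chart j (h * g)"
    proof (rule poly_eqI)
      fix e
      show "Polynomial.coeff (chart j f) e = Polynomial.coeff (chart j (h * g)) e"
        using deg[of e] by (auto simp: q h g coeff_monom_mult coeff_poly_shift)
    qed
    then have "f = h * g" by (simp only: chart_inject)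
    then show ?thesis by simp
  qed
  with h show ?thesis by blast
qed

text \<open>
  Let \<open>h\<close> generate the prime above \<open>Q\<close>. As \<open>h \<notin> Q\<close>, every \<open>f \<in> Q\<close> factors as \<open>h g\<close> with \<open>g \<in> Q\<close> of smaller
  degree; iterating this is impossible unless \<open>f = 0\<close>.
\<close>

lemma prime_below_chart_prime_eq_zero:
  fixes p :: "'k::field poly"
  assumes p: "prime_elem p" and Q: "primeideal Q mpoly_ring" and "Q \<subset> chart_prime j p"
  shows "Q = {0}"
proof -
  obtain h where h: "chart j h = Polynomial.monom p (Polynomial.degree p)"
    and dvd: "\<And>f. f \<in> chart_prime j p \<Longrightarrow> h dvd f"
    using chart_prime_principal[OF p] by meson
  have Q': "ideal_span.subspace Q"
    using primeideal.axioms(1)[OF Q] by (simp add: ideal_iff_subspace)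
  have "h \<notin> Q"
  proof
    assume "h \<in> Q"
    have "f \<in> Q" if f: "f \<in> chart_prime j p" for f
    proof -
      obtain g where "f = h * g" using dvd[OF f] by (rule dvdE)
      then show ?thesis
        using ideal_span.subspace_scale[OF Q' \<open>h \<in> Q\<close>, of g] by (simp only: mult.commute)
    qed
    then show False using \<open>Q \<subset> chart_prime j p\<close> by blast
  qed
  have "Polynomial.degree p > 0"
    using p by (auto simp: prime_elem_def is_unit_iff_degree)
  have "f = 0" if "f \<in> Q" for f
    using that
  proof (induction "Polynomial.degree (chart j f)" arbitrary: f rule: less_induct)
    case less
    then obtain g where g: "f = h * g" using dvd \<open>Q \<subset> chart_prime j p\<close> by (meson dvdE psubsetD)
    have "g \<in> Q"
      using primeideal.I_prime[OF Q, of h g] less.prems g \<open>h \<notin> Q\<close> by auto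
    show ?case
    proof (rule ccontr)
      assume "f \<noteq> 0"
      then have "g \<noteq> 0" using g by auto
      then have "chart j g \<noteq> 0" using chart_inject[of g 0] by simp
      have "Polynomial.monom p (Polynomial.degree p) \<noteq> 0" using p by auto
      then have "Polynomial.degree (chart j f) = Polynomial.degree p + Polynomial.degree (chart j g)"
        using \<open>chart j g \<noteq> 0\<close> p by (simp add: g h degree_mult_eq degree_monom_eq)
      then show False using less.hyps[OF _ \<open>g \<in> Q\<close>] \<open>g \<noteq> 0\<close> \<open>Polynomial.degree p > 0\<close> by simp
    qed
  qed
  then show ?thesis using ideal_span.subspace_0[OF Q'] by blast
qed

lemma prime_height_chart_prime_le_1:
  fixes p :: "'k::field poly"
  assumes p: "prime_elem p"
  shows "prime_height mpoly_ring (chart_prime j p) \<le> 1"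
  unfolding prime_height_def
proof (rule SUP_least)
  fix k
  assume "k \<in> {k. \<exists>C :: nat \<Rightarrow> ('n, 'k) mpoly set. (\<forall>l\<le>k. primeideal (C l) mpoly_ring) \<and>
    (\<forall>l<k. C l \<subset> C (Suc l)) \<and> C k = chart_prime j p}"
  then obtain C :: "nat \<Rightarrow> ('n, 'k) mpoly set" where C: "\<forall>l\<le>k. primeideal (C l) mpoly_ring"
    "\<forall>l<k. C l \<subset> C (Suc l)" "C k = chart_prime j p" by blast
  have "k \<le> 1"
  proof (rule ccontr)
    assume "\<not> k \<le> 1"
    define l where "l = k - 2"
    have k: "k = Suc (Suc l)" using \<open>\<not> k \<le> 1\<close> by (simp add: l_def)
    have "primeideal (C (Suc l)) mpoly_ring" "C (Suc l) \<subset> chart_prime j p" using C k by auto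
    then have "C (Suc l) = {0}" by (rule prime_below_chart_prime_eq_zero[OF p])
    moreover have "ideal (C l) mpoly_ring" using C(1) k by (auto intro: primeideal.axioms(1))
    then have "0 \<in> C l" by (simp add: ideal_iff_subspace ideal_span.subspace_0)
    moreover have "C l \<subset> C (Suc l)" using C(2) k by auto
    ultimately show False by auto
  qed
  then show "enat k \<le> 1" by (simp add: one_enat_def)
qed

text \<open>
  The set \<open>J\<close> of all \<open>a\<close> such that \<open>a s\<^sup>N\<close> is the image of some element of \<open>L\<close> is an ideal of \<open>K[t]\<close>. A common
  prime factor \<open>p\<close> of \<open>J\<close> would put \<open>L\<close> inside a prime ideal of height at most one. Hence \<open>1 \<in> J\<close>, which
  means that some \<open>s\<^sup>N\<close> comes from \<open>L\<close>.
\<close>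

lemma power_Var_in_if_height_2:
  fixes L :: "('n, 'k::field) mpoly set"
  assumes L: "generated_in_degree d L" and height: "2 \<le> ideal_height mpoly_ring L"
  shows "\<exists>N. Var i ^ N \<in> L"
proof -
  have id: "ideal_span.subspace L"
    using generated_in_degree_imp_ideal[OF L] by (simp add: ideal_iff_subspace)
  define J where "J = {a. \<exists>N f. f \<in> L \<and> chart j f = Polynomial.monom a N}"
  have "ideal_span.subspace J"
  proof (rule ideal_span.subspaceI)
    show "0 \<in> J" using ideal_span.subspace_0[OF id] by (force simp: J_def)
  next
    fix a a' assume "a \<in> J" "a' \<in> J"
    then obtain N N' f f' where f: "f \<in> L" "chart j f = Polynomial.monom a N"
      "f' \<in> L" "chart j f' = Polynomial.monom a' N'" by (auto simp: J_def)
    \<comment> \<open>Multiplying by powers of the variable \<open>i\<close>, which maps to \<open>s\<close>, brings both to the same degree.\<close>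
    let ?g = "Var i ^ N' * f + Var i ^ N * f'"
    have "?g \<in> L" using id f by (intro ideal_span.subspace_add ideal_span.subspace_scale)
    moreover have "chart j ?g = Polynomial.monom (a + a') (N + N')"
      by (simp add: chart_Var_power f mult_monom add_monom add.commute)
    ultimately show "a + a' \<in> J" unfolding J_def by blast
  next
    fix c a assume "a \<in> J"
    then obtain N f where f: "f \<in> L" "chart j f = Polynomial.monom a N" by (auto simp: J_def)
    obtain g :: "('n, 'k) mpoly" where "chart j g = Polynomial.monom c (Polynomial.degree c)"
      by (rule chart_monom_image[OF order_refl])
    then have "chart j (g * f) = Polynomial.monom (c * a) (Polynomial.degree c + N)"
      by (simp add: f mult_monom)
    then show "c * a \<in> J" using ideal_span.subspace_scale[OF id f(1), of g] unfolding J_def by blast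
  qed
  moreover have False if p: "prime_elem p" and dvd: "\<And>a. a \<in> J \<Longrightarrow> p dvd a" for p
  proof -
    have "f \<in> chart_prime j p" if f: "f \<in> degree_part d L" for f
    proof -
      have eq: "chart j f = Polynomial.monom (Polynomial.coeff (chart j f) d) d"
        using f by (intro chart_homogeneous) (simp add: degree_part_def)
      then have "Polynomial.coeff (chart j f) d \<in> J" using f by (auto simp: J_def degree_part_def)
      then have "[:p:] dvd Polynomial.monom (Polynomial.coeff (chart j f) d) d"
        by (auto simp: const_poly_dvd_iff intro: dvd)
      then show ?thesis by (simp add: chart_prime_def flip: eq)
    qed
    then have "ideal_span.span (degree_part d L) \<subseteq> chart_prime j p"
      using primeideal.axioms(1)[OF primeideal_chart_prime[OF p]]
      by (intro ideal_span.span_minimal) (auto simp: ideal_iff_subspace)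
    then have "L \<subseteq> chart_prime j p" by (simp add: span_degree_part[OF L])
    then have "ideal_height mpoly_ring L \<le> prime_height mpoly_ring (chart_prime j p)"
      unfolding ideal_height_def using primeideal_chart_prime[OF p] by (intro INF_lower) auto
    also have "\<dots> \<le> 1" by (rule prime_height_chart_prime_le_1[OF p])
    finally have "(2 :: enat) \<le> 1" using height by (rule order_trans[rotated])
    then show False by (simp add: one_enat_def numeral_eq_enat)
  qed
  ultimately have "1 \<in> J" using poly_ideal_proper_imp_common_prime_factor by metis
  then obtain N f where f: "f \<in> L" "chart j f = Polynomial.monom 1 N" by (auto simp: J_def)
  then have "f = Var i ^ N" by (simp add: chart_Var_power flip: chart_inject)
  then show ?thesis using f(1) by blast
qed

end

section \<open>Contracted ideals in two variables\<close>

text \<open>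
  By symmetry a power of each of the two variables lies in \<open>L\<close>, and a monomial of large degree is
  divisible by one of these powers.
\<close>

lemma order_ge_subset_if_height_2:
  fixes L :: "('n::{finite,linorder}, 'k::field) mpoly set"
  assumes card: "card (UNIV :: 'n set) = 2" and L: "generated_in_degree d L"
    and height: "2 \<le> ideal_height mpoly_ring L"
  obtains N where "order_ge N \<subseteq> L"
proof -
  obtain i j :: 'n where ij: "UNIV = {i, j}" "i \<noteq> j" using card by (auto simp: card_2_iff)
  then have ji: "UNIV = {j, i}" "j \<noteq> i" by auto
  obtain A where A: "Var i ^ A \<in> L" using power_Var_in_if_height_2[OF ij L height] by blast
  obtain B where B: "Var j ^ B \<in> L" using power_Var_in_if_height_2[OF ji L height] by blast
  have id: "ideal_span.subspace L"
    using generated_in_degree_imp_ideal[OF L] by (simp add: ideal_iff_subspace)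
  have pow: "Var k ^ n = Poly_Mapping.single (Poly_Mapping.single k n) (1::'k)" for k :: 'n and n
    by (induction n) (simp_all add: Var_def mult_single flip: single_add)
  have split: "Poly_Mapping.single m c \<in> L" if "Poly_Mapping.single (Poly_Mapping.single k n) (1::'k) \<in> L" "n \<le> Poly_Mapping.lookup m k"
    for m :: "'n \<Rightarrow>\<^sub>0 nat" and c k n
  proof -
    have "m = (m - Poly_Mapping.single k n) + Poly_Mapping.single k n"
      using that(2) by (intro poly_mapping_eqI) (auto simp: lookup_add lookup_minus lookup_single when_def)
    then have "Poly_Mapping.single m c
        = Poly_Mapping.single (m - Poly_Mapping.single k n) c * Poly_Mapping.single (Poly_Mapping.single k n) 1"
      by (simp add: mult_single)
    then show ?thesis using ideal_span.subspace_scale[OF id that(1)] by simp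
  qed
  have "f \<in> L" if f: "f \<in> order_ge (A + B)" for f
  proof -
    have "Poly_Mapping.single m (Poly_Mapping.lookup f m) \<in> L" if "m \<in> Poly_Mapping.keys f" for m
    proof -
      have "A + B \<le> Poly_Mapping.lookup m i + Poly_Mapping.lookup m j"
        using f that by (auto simp: order_ge_def in_keys_iff simp flip: total_degree_two[OF ij])
      then have "A \<le> Poly_Mapping.lookup m i \<or> B \<le> Poly_Mapping.lookup m j" by linarith
      then show ?thesis using split A B by (auto simp: pow)
    qed
    then have "(\<Sum>m\<in>Poly_Mapping.keys f. Poly_Mapping.single m (Poly_Mapping.lookup f m)) \<in> L"
      by (intro ideal_span.subspace_sum[OF id])
    then show ?thesis by (simp flip: mpoly_eq_sum_single)
  qed
  then show thesis using that by blast
qed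

lemma to_fract_simps [simp]:
  fixes a b :: "'a::idom"
  shows "to_fract (0 :: 'a) = 0" "to_fract (1 :: 'a) = 1" "to_fract (a + b) = to_fract a + to_fract b"
  "to_fract (a * b) = to_fract a * to_fract b" "to_fract (a ^ n) = to_fract a ^ n"
proof -
  show mult: "to_fract (a * b) = to_fract a * to_fract b" for a b :: 'a by (simp add: to_fract_def)
  show one: "to_fract (1 :: 'a) = 1" by (simp add: to_fract_def One_fract_def)
  show "to_fract (a ^ n) = to_fract a ^ n" by (induction n) (simp_all add: mult one)
qed (simp_all add: to_fract_def Zero_fract_def)

lemma to_fract_eq_0_iff [simp]: "to_fract a = 0 \<longleftrightarrow> a = 0"
  by (simp add: to_fract_def Zero_fract_def eq_fract)

lemma to_fract_sum: "to_fract (sum f A) = (\<Sum>a\<in>A. to_fract (f a))"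
  by (induction A rule: infinite_finite_induct) simp_all

lemma graded_max_ideal_subset_order_ge: "graded_max_ideal \<subseteq> (order_ge 1 :: ('n::finite, 'k::field) mpoly set)"
  unfolding graded_max_ideal_def genideal_eq_span
  by (intro ideal_span.span_minimal subspace_order_ge) (auto simp: Var_def)

lemma blowup_ring_simps:
  "x \<otimes>\<^bsub>blowup_ring y\<^esub> z = x * z" "x \<oplus>\<^bsub>blowup_ring y\<^esub> z = x + z" "\<zero>\<^bsub>blowup_ring y\<^esub> = 0"
  by (simp_all add: blowup_ring_def ring_of_type_algebra_def)

lemma
  shows to_fract_in_blowup_ring: "to_fract r \<in> carrier (blowup_ring x)"
    and to_fract_div_in_blowup_ring: "a \<in> graded_max_ideal \<Longrightarrow> to_fract a / to_fract x \<in> carrier (blowup_ring x)"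
    and add_in_blowup_ring: "s \<in> carrier (blowup_ring x) \<Longrightarrow> t \<in> carrier (blowup_ring x) \<Longrightarrow> s + t \<in> carrier (blowup_ring x)"
    and mult_in_blowup_ring: "s \<in> carrier (blowup_ring x) \<Longrightarrow> t \<in> carrier (blowup_ring x) \<Longrightarrow> s * t \<in> carrier (blowup_ring x)"
  using generate_ring.eng_add[of s ring_of_type_algebra _ t] generate_ring.eng_mult[of s ring_of_type_algebra _ t]
  by (auto simp: blowup_ring_def intro: generate_ring.incl)

text \<open>
  A monomial of degree at least \<open>k\<close> contains \<open>k\<close> variables, each of which may be divided by \<open>x\<close>.
\<close>

lemma order_ge_div_power_in_blowup_ring:
  fixes x :: "('n::{finite,linorder}, 'k::field) mpoly"
  assumes "f \<in> order_ge k"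
  shows "to_fract f / to_fract x ^ k \<in> carrier (blowup_ring x)"
proof -
  let ?T = "carrier (blowup_ring x)"
  have single: "to_fract (Poly_Mapping.single m c) / to_fract x ^ k \<in> ?T" if "k \<le> total_degree m"
    for m :: "'n \<Rightarrow>\<^sub>0 nat" and c :: 'k
    using that
  proof (induction k arbitrary: m)
    case 0
    then show ?case by (simp add: to_fract_in_blowup_ring)
  next
    case (Suc k)
    then have "m \<noteq> 0" by auto
    then obtain i where i: "Poly_Mapping.lookup m i \<noteq> 0" by (metis lookup_zero poly_mapping_eqI)
    define m' where "m' = m - Poly_Mapping.single i 1"
    have m: "m = Poly_Mapping.single i 1 + m'"
      using i by (intro poly_mapping_eqI) (auto simp: m'_def lookup_add lookup_minus lookup_single when_def)
    have "Poly_Mapping.single m c = Var i * Poly_Mapping.single m' c"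
      by (simp add: m Var_def mult_single)
    then have "to_fract (Poly_Mapping.single m c) / to_fract x ^ Suc k
        = (to_fract (Var i) / to_fract x) * (to_fract (Poly_Mapping.single m' c) / to_fract x ^ k)"
      by simp
    moreover have "k \<le> total_degree m'" using Suc.prems by (simp add: m)
    moreover have "Var i \<in> graded_max_ideal"
      unfolding graded_max_ideal_def genideal_eq_span by (intro ideal_span.span_base) auto
    ultimately show ?case
      using Suc.IH by (simp only:) (intro mult_in_blowup_ring to_fract_div_in_blowup_ring)
  qed
  have sum: "(\<Sum>a\<in>A. g a) \<in> ?T" if "finite A" "\<And>a. a \<in> A \<Longrightarrow> g a \<in> ?T" for A :: "('n \<Rightarrow>\<^sub>0 nat) set" and g
    using that
  proof (induction A)
    case empty
    show ?case using to_fract_in_blowup_ring[of 0 x] by simp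
  qed (simp add: add_in_blowup_ring)
  have "to_fract f / to_fract x ^ k
      = to_fract (\<Sum>m\<in>Poly_Mapping.keys f. Poly_Mapping.single m (Poly_Mapping.lookup f m)) / to_fract x ^ k"
    by (simp flip: mpoly_eq_sum_single)
  also have "\<dots> = (\<Sum>m\<in>Poly_Mapping.keys f. to_fract (Poly_Mapping.single m (Poly_Mapping.lookup f m)) / to_fract x ^ k)"
    by (simp add: to_fract_sum sum_divide_distrib)
  also have "\<dots> \<in> ?T"
    using assms by (intro sum single) (auto simp: order_ge_def in_keys_iff)
  finally show ?thesis .
qed

text \<open>
  The heart of the equality case: \<open>x\<^sup>d \<in> L T\<close>, hence \<open>L T\<close> contains every \<open>f = (f/x\<^sup>d) x\<^sup>d\<close> of order at
  least \<open>d\<close>. The element \<open>x\<close> need not be homogeneous, so the argument runs through the order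
  filtration instead of homogeneous components.
\<close>

lemma contracted_imp_order_ge_subset:
  fixes L :: "('n::{finite,linorder}, 'k::field) mpoly set"
  assumes L: "generated_in_degree d L" and N: "order_ge N \<subseteq> L" and contr: "contracted L"
  shows "order_ge d \<subseteq> L"
proof
  fix f :: "('n, 'k) mpoly" assume f: "f \<in> order_ge d"
  obtain x where x: "x \<in> graded_max_ideal" "x \<notin> ideal_prod mpoly_ring graded_max_ideal graded_max_ideal"
    and Lx: "L = {a. to_fract a \<in> genideal (blowup_ring x) (to_fract ` L)}"
    using contr by (auto simp: contracted_def)
  have "0 \<in> (graded_max_ideal :: ('n, 'k) mpoly set)"
    unfolding graded_max_ideal_def genideal_eq_span by (rule ideal_span.span_zero)
  then have "x \<noteq> 0" using x(2) mult_in_ideal_prod[of 0 graded_max_ideal 0 graded_max_ideal] by auto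
  have "to_fract f \<in> J" if J: "ideal J (blowup_ring x)" "to_fract ` L \<subseteq> J" for J
  proof -
    have scale: "t * s \<in> J" if "s \<in> J" "t \<in> carrier (blowup_ring x)" for s t
      using ideal.I_l_closed[OF J(1) that] by (simp add: blowup_ring_simps)
    have add: "s + t \<in> J" if "s \<in> J" "t \<in> J" for s t
      using additive_subgroup.a_closed[OF ideal.axioms(1)[OF J(1)] that] by (simp add: blowup_ring_simps)
    have zero: "0 \<in> J"
      using additive_subgroup.zero_closed[OF ideal.axioms(1)[OF J(1)]] by (simp add: blowup_ring_simps)
    define M where "M = N + d"
    \<comment> \<open>Modulo polynomials with terms of degree below \<open>N + d\<close> only, every element of \<open>L\<close> is a combination of forms of degree \<open>d\<close> in \<open>L\<close> with coefficients in \<open>\<mm>\<^sup>N\<close>.\<close>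
    have approx: "\<exists>g h. p = g + h \<and> g \<in> order_ge M \<and> to_fract g / to_fract x ^ N \<in> J
        \<and> (\<forall>m. Poly_Mapping.lookup h m \<noteq> 0 \<longrightarrow> total_degree m < M)" if "p \<in> ideal_span.span (degree_part d L)" for p
      using that
    proof (induction rule: ideal_span.span_induct_alt)
      case base
      show ?case using zero by (intro exI[of _ 0]) (simp add: order_ge_def)
    next
      case (step c v y)
      then have v: "v \<in> L" "homogeneous d v" by (auto simp: degree_part_def)
      obtain g h where gh: "y = g + h" "g \<in> order_ge M" "to_fract g / to_fract x ^ N \<in> J"
        "\<And>m. Poly_Mapping.lookup h m \<noteq> 0 \<Longrightarrow> total_degree m < M" using step(2) by blast
      obtain c1 c2 where c: "c = c1 + c2" "c1 \<in> order_ge N"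
        "\<And>m. Poly_Mapping.lookup c2 m \<noteq> 0 \<Longrightarrow> total_degree m < N"
        using mpoly_split_at_degree[of c N] by blast
      have low: "total_degree m < M" if m: "Poly_Mapping.lookup (c2 * v) m \<noteq> 0" for m
      proof -
        obtain a b where "m = a + b" "Poly_Mapping.lookup c2 a \<noteq> 0" "Poly_Mapping.lookup v b \<noteq> 0"
          using m keys_mult[of c2 v] by (auto simp: in_keys_iff subset_iff)
        then show ?thesis using c(3)[of a] v(2) by (auto simp: M_def homogeneous_iff)
      qed
      have "to_fract (c1 * v + g) / to_fract x ^ N
          = (to_fract c1 / to_fract x ^ N) * to_fract v + to_fract g / to_fract x ^ N"
        by (simp add: add_divide_distrib)
      also have "\<dots> \<in> J"
        using J(2) v(1) c(2) gh(3) by (intro add scale order_ge_div_power_in_blowup_ring) auto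
      finally have "to_fract (c1 * v + g) / to_fract x ^ N \<in> J" .
      moreover have "c1 * v + g \<in> order_ge M"
        using order_ge_mult[OF c(2) homogeneous_imp_order_ge[OF v(2)]] gh(2)
        by (simp add: M_def order_ge_add)
      moreover have "total_degree m < M" if "Poly_Mapping.lookup (c2 * v + h) m \<noteq> 0" for m
        using that low[of m] gh(4)[of m]
        by (cases "Poly_Mapping.lookup h m = 0") (auto simp: lookup_add)
      moreover have "c * v + y = (c1 * v + g) + (c2 * v + h)" by (simp add: c gh algebra_simps)
      ultimately show ?case by blast
    qed
    have "x \<in> order_ge 1" using x(1) graded_max_ideal_subset_order_ge by blast
    have pow: "x ^ n \<in> order_ge n" for n
    proof (induction n)
      case (Suc n)
      show ?case using order_ge_mult[OF \<open>x \<in> order_ge 1\<close> Suc] by simp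
    qed simp
    have "x ^ M \<in> order_ge N" using pow[of M] by (auto simp: order_ge_def M_def)
    then obtain g h where gh: "x ^ M = g + h" "g \<in> order_ge M" "to_fract g / to_fract x ^ N \<in> J"
      "\<And>m. Poly_Mapping.lookup h m \<noteq> 0 \<Longrightarrow> total_degree m < M"
      using approx[of "x ^ M"] N unfolding span_degree_part[OF L] by blast
    \<comment> \<open>Both \<open>x\<^sup>M\<close> and \<open>g\<close> have order at least \<open>M\<close>, whereas \<open>h\<close> has terms of degree below \<open>M\<close> only.\<close>
    have "h = 0"
    proof (rule poly_mapping_eqI)
      fix m
      have "Poly_Mapping.lookup (x ^ M) m = Poly_Mapping.lookup g m + Poly_Mapping.lookup h m"
        by (simp add: gh(1) lookup_add)
      moreover have "Poly_Mapping.lookup (x ^ M) m = 0" "Poly_Mapping.lookup g m = 0"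
        if "total_degree m < M"
        using that pow[of M] gh(2) by (auto simp: order_ge_def dest: leD)
      ultimately show "Poly_Mapping.lookup h m = Poly_Mapping.lookup 0 m"
        using gh(4)[of m] by (cases "Poly_Mapping.lookup h m = 0") auto
    qed
    then have "g = x ^ N * x ^ d" using gh(1) by (simp add: M_def power_add)
    then have "to_fract x ^ d \<in> J" using gh(3) \<open>x \<noteq> 0\<close> by simp
    then have "(to_fract f / to_fract x ^ d) * to_fract x ^ d \<in> J"
      by (intro scale order_ge_div_power_in_blowup_ring f)
    then show ?thesis using \<open>x \<noteq> 0\<close> by simp
  qed
  then have "to_fract f \<in> genideal (blowup_ring x) (to_fract ` L)" by (auto simp: genideal_def)
  then show "f \<in> L" using Lx by blast
qed

lemma min_num_gens_le_two_vars:
  fixes L :: "('n::{finite,linorder}, 'k::field) mpoly set"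
  assumes "card (UNIV :: 'n set) = 2" and L: "generated_in_degree d L"
  shows "min_num_gens mpoly_ring L \<le> d + 1"
proof -
  obtain i j :: 'n where ij: "UNIV = {i, j}" "i \<noteq> j" using assms(1) by (auto simp: card_2_iff)
  have "leads (degree_part d L) \<subseteq> {m. total_degree m = d}"
    using lookup_lead_neq_0 by (auto simp: leads_def degree_part_def homogeneous_iff)
  then have "card (leads (degree_part d L)) \<le> card {m :: 'n \<Rightarrow>\<^sub>0 nat. total_degree m = d}"
    by (intro card_mono finite_monomials_of_degree)
  then show ?thesis
    by (simp add: min_num_gens_eq_card_leads[OF L] card_monomials_of_degree_two[OF ij])
qed

lemma min_num_gens_contracted:
  fixes L :: "('n::{finite,linorder}, 'k::field) mpoly set"
  assumes card: "card (UNIV :: 'n set) = 2" and L: "generated_in_degree d L"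
    and height: "ideal_height mpoly_ring L = 2" and contr: "contracted L"
  shows "min_num_gens mpoly_ring L = d + 1"
proof (rule antisym[OF min_num_gens_le_two_vars[OF card L]])
  obtain i j :: 'n where ij: "UNIV = {i, j}" "i \<noteq> j" using card by (auto simp: card_2_iff)
  obtain N where "order_ge N \<subseteq> L"
    using order_ge_subset_if_height_2[OF card L] height by auto
  then have sub: "order_ge d \<subseteq> L" by (rule contracted_imp_order_ge_subset[OF L _ contr])
  have "m \<in> leads (degree_part d L)" if "total_degree m = d" for m
  proof -
    have "Poly_Mapping.single m (1::'k) \<noteq> 0" by (metis lookup_single_eq lookup_zero zero_neq_one)
    then have "Poly_Mapping.single m (1::'k) \<in> degree_part d L - {0}"
      using that sub by (auto simp: degree_part_def homogeneous_def)
    moreover have "lead (Poly_Mapping.single m (1::'k)) = m" by (simp add: lead_def)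
    ultimately show ?thesis unfolding leads_def by (metis imageI)
  qed
  then have "card {m :: 'n \<Rightarrow>\<^sub>0 nat. total_degree m = d} \<le> card (leads (degree_part d L))"
    by (intro card_mono finite_leads_degree_part) auto
  then show "d + 1 \<le> min_num_gens mpoly_ring L"
    by (simp add: min_num_gens_eq_card_leads[OF L] card_monomials_of_degree_two[OF ij])
qed

section \<open>Finite products and powers\<close>

lemma ideals_set_simps:
  "carrier (ideals_set R) = {I. ideal I R}"
  "monoid.mult (ideals_set R) = ideal_prod R"
  "monoid.one (ideals_set R) = carrier R"
  by (simp_all add: ideals_set_def)

lemma finprod_ideals_Suc:
  fixes I :: "nat \<Rightarrow> 'a::comm_ring_1 set"
  assumes "\<And>j. j \<in> {1..Suc r} \<Longrightarrow> ideal (I j) ring_of_type_algebra"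
  shows "(\<Otimes>\<^bsub>ideals_set ring_of_type_algebra\<^esub> j\<in>{1..Suc r}. I j)
    = ideal_prod ring_of_type_algebra (I (Suc r)) (\<Otimes>\<^bsub>ideals_set ring_of_type_algebra\<^esub> j\<in>{1..r}. I j)"
proof -
  interpret cring "ring_of_type_algebra :: 'a ring" by (rule cring_from_type_algebra)
  interpret ideals: comm_monoid "ideals_set (ring_of_type_algebra :: 'a ring)"
    by (rule ideals_set_is_comm_monoid)
  have "{1..Suc r} = insert (Suc r) {1..r}" by auto
  then show ?thesis
    using assms by (simp add: ideals.finprod_insert Pi_def ideals_set_simps)
qed

lemma finprod_ideals_empty:
  "(\<Otimes>\<^bsub>ideals_set (ring_of_type_algebra :: 'a::comm_ring_1 ring)\<^esub> j\<in>{}. I j) = UNIV"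
proof -
  interpret cring "ring_of_type_algebra :: 'a ring" by (rule cring_from_type_algebra)
  interpret ideals: comm_monoid "ideals_set (ring_of_type_algebra :: 'a ring)"
    by (rule ideals_set_is_comm_monoid)
  show ?thesis by (simp add: ideals.finprod_empty ideals_set_simps)
qed

lemma min_num_gens_finprod_ge:
  fixes I :: "nat \<Rightarrow> ('n::{finite,linorder}, 'k::field) mpoly set"
  assumes "\<And>j. j \<in> {1..r} \<Longrightarrow> generated_in_degree (d j) (I j) \<and> I j \<noteq> {0}"
  defines "P \<equiv> \<Otimes>\<^bsub>ideals_set mpoly_ring\<^esub> j\<in>{1..r}. I j"
  shows "generated_in_degree (\<Sum>j=1..r. d j) P \<and> P \<noteq> {0} \<and>
    (\<Sum>j=1..r. min_num_gens mpoly_ring (I j)) + 1 \<le> min_num_gens mpoly_ring P + r"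
  using assms(1) unfolding P_def
proof (induction r)
  case 0
  have UNIV_neq: "UNIV \<noteq> {0 :: ('n, 'k) mpoly}" by (metis UNIV_I singletonD zero_neq_one)
  have "0 < min_num_gens mpoly_ring (UNIV :: ('n, 'k) mpoly set)"
    using leads_degree_part_nonempty[OF generated_in_degree_UNIV UNIV_neq]
    by (simp add: min_num_gens_eq_card_leads[OF generated_in_degree_UNIV] card_gt_0_iff finite_leads_degree_part)
  then show ?case by (simp add: finprod_ideals_empty generated_in_degree_UNIV UNIV_neq)
next
  case (Suc r)
  let ?P = "\<Otimes>\<^bsub>ideals_set mpoly_ring\<^esub> j\<in>{1..r}. I j"
  have P: "generated_in_degree (\<Sum>j=1..r. d j) ?P" "?P \<noteq> {0}"
    "(\<Sum>j=1..r. min_num_gens mpoly_ring (I j)) + 1 \<le> min_num_gens mpoly_ring ?P + r"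
    using Suc by auto
  have I: "generated_in_degree (d (Suc r)) (I (Suc r))" "I (Suc r) \<noteq> {0}"
    using Suc.prems[of "Suc r"] by auto
  have "(\<Otimes>\<^bsub>ideals_set mpoly_ring\<^esub> j\<in>{1..Suc r}. I j) = ideal_prod mpoly_ring (I (Suc r)) ?P"
    using Suc.prems by (intro finprod_ideals_Suc) (blast intro: generated_in_degree_imp_ideal)
  then show ?case
    using min_num_gens_prod_ge[OF I P(1,2)] P(3) generated_in_degree_prod[OF I(1) P(1)]
      ideal_prod_neq_zero[OF generated_in_degree_imp_ideal[OF I(1)] generated_in_degree_imp_ideal[OF P(1)] I(2) P(2)]
    by (simp add: add.commute)
qed

lemma pow_ideals_eq_finprod:
  fixes I :: "'a::comm_ring_1 set" and k :: nat
  assumes "ideal I ring_of_type_algebra"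
  shows "I [^]\<^bsub>ideals_set ring_of_type_algebra\<^esub> k = (\<Otimes>\<^bsub>ideals_set ring_of_type_algebra\<^esub> j\<in>{1..k}. I)"
proof -
  interpret cring "ring_of_type_algebra :: 'a ring" by (rule cring_from_type_algebra)
  interpret ideals: comm_monoid "ideals_set (ring_of_type_algebra :: 'a ring)"
    by (rule ideals_set_is_comm_monoid)
  show ?thesis using assms by (simp add: ideals.finprod_const ideals_set_simps)
qed

text \<open>
  The product is generated in degree \<open>D = \<Sum> d\<^sub>j\<close>, so \<open>D + 1\<close> bounds \<open>\<mu>\<close> from above; as every \<open>\<mu>(I\<^sub>j)\<close> is
  \<open>d\<^sub>j + 1\<close>, the general lower bound is the same number.
\<close>

lemma min_num_gens_finprod_contracted:
  fixes I :: "nat \<Rightarrow> ('n::{finite,linorder}, 'k::field) mpoly set"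
  assumes card: "card (UNIV :: 'n set) = 2"
    and I: "\<And>j. j \<in> {1..r} \<Longrightarrow> generated_in_degree (d j) (I j) \<and> I j \<noteq> {0} \<and>
      ideal_height mpoly_ring (I j) = 2 \<and> contracted (I j)"
  shows "min_num_gens mpoly_ring (\<Otimes>\<^bsub>ideals_set mpoly_ring\<^esub> j\<in>{1..r}. I j) + r
    = (\<Sum>j=1..r. min_num_gens mpoly_ring (I j)) + 1"
proof -
  let ?P = "\<Otimes>\<^bsub>ideals_set mpoly_ring\<^esub> j\<in>{1..r}. I j"
  have P: "generated_in_degree (\<Sum>j=1..r. d j) ?P"
    "(\<Sum>j=1..r. min_num_gens mpoly_ring (I j)) + 1 \<le> min_num_gens mpoly_ring ?P + r"
    using min_num_gens_finprod_ge[of r d I] I by auto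
  have "(\<Sum>j=1..r. min_num_gens mpoly_ring (I j)) = (\<Sum>j=1..r. d j + 1)"
    using I by (intro sum.cong refl min_num_gens_contracted[OF card]) auto
  moreover have "min_num_gens mpoly_ring ?P \<le> (\<Sum>j=1..r. d j) + 1"
    by (rule min_num_gens_le_two_vars[OF card P(1)])
  ultimately show ?thesis using P(2) by (simp add: sum_Suc)
qed

theorem corollary1p8:
  shows
    "(\<forall>(I :: nat \<Rightarrow> ('n::{finite,linorder}, 'k::field) mpoly set) (r :: nat).
        1 \<le> r \<and> (\<forall>j\<in>{1..r}. equigenerated (I j) \<and> I j \<noteq> {0}) \<longrightarrow>
        int (min_num_gens mpoly_ring (\<Otimes>\<^bsub>ideals_set mpoly_ring\<^esub> j\<in>{1..r}. I j))
          \<ge> (\<Sum>j=1..r. int (min_num_gens mpoly_ring (I j))) - (int r - 1))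
   \<and> (\<forall>(I :: ('n, 'k) mpoly set) (k :: nat).
        equigenerated I \<and> I \<noteq> {0} \<longrightarrow>
        int (min_num_gens mpoly_ring (I [^]\<^bsub>ideals_set mpoly_ring\<^esub> k))
          \<ge> int k * (int (min_num_gens mpoly_ring I) - 1) + 1)
   \<and> (card (UNIV :: 'n set) = 2 \<and> infinite (UNIV :: 'k set) \<longrightarrow>
       (\<forall>(I :: nat \<Rightarrow> ('n, 'k) mpoly set) (r :: nat).
          1 \<le> r \<and> (\<forall>j\<in>{1..r}. equigenerated (I j) \<and> I j \<noteq> {0} \<and>
                             ideal_height mpoly_ring (I j) = 2 \<and> contracted (I j)) \<longrightarrow>
          int (min_num_gens mpoly_ring (\<Otimes>\<^bsub>ideals_set mpoly_ring\<^esub> j\<in>{1..r}. I j))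
            = (\<Sum>j=1..r. int (min_num_gens mpoly_ring (I j))) - (int r - 1))
     \<and> (\<forall>(I :: ('n, 'k) mpoly set) (k :: nat).
          equigenerated I \<and> I \<noteq> {0} \<and> ideal_height mpoly_ring I = 2 \<and> contracted I \<longrightarrow>
          int (min_num_gens mpoly_ring (I [^]\<^bsub>ideals_set mpoly_ring\<^esub> k))
            = int k * (int (min_num_gens mpoly_ring I) - 1) + 1))"
proof (intro conjI impI allI)
  fix I :: "nat \<Rightarrow> ('n, 'k) mpoly set" and r :: nat
  assume I: "1 \<le> r \<and> (\<forall>j\<in>{1..r}. equigenerated (I j) \<and> I j \<noteq> {0})"
  then have "\<forall>j\<in>{1..r}. \<exists>d. generated_in_degree d (I j)"
    using equigenerated_imp_generated_in_degree by blast
  then obtain d where "\<forall>j\<in>{1..r}. generated_in_degree (d j) (I j)"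
    using bchoice[of "{1..r}" "\<lambda>j d. generated_in_degree d (I j)"] by blast
  then show "int (min_num_gens mpoly_ring (\<Otimes>\<^bsub>ideals_set mpoly_ring\<^esub> j\<in>{1..r}. I j))
      \<ge> (\<Sum>j=1..r. int (min_num_gens mpoly_ring (I j))) - (int r - 1)"
    using min_num_gens_finprod_ge[of r d I] I by (simp flip: of_nat_sum)
next
  fix I :: "('n, 'k) mpoly set" and k :: nat
  assume I: "equigenerated I \<and> I \<noteq> {0}"
  then obtain d where d: "generated_in_degree d I"
    using equigenerated_imp_generated_in_degree by blast
  from min_num_gens_finprod_ge[of k "\<lambda>_. d" "\<lambda>_. I"] I d
  have "int (k * min_num_gens mpoly_ring I + 1) \<le> int (min_num_gens mpoly_ring (I [^]\<^bsub>ideals_set mpoly_ring\<^esub> k) + k)"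
    by (subst of_nat_le_iff) (simp add: pow_ideals_eq_finprod generated_in_degree_imp_ideal)
  then show "int (min_num_gens mpoly_ring (I [^]\<^bsub>ideals_set mpoly_ring\<^esub> k))
      \<ge> int k * (int (min_num_gens mpoly_ring I) - 1) + 1"
    by (simp add: algebra_simps)
next
  fix I :: "nat \<Rightarrow> ('n, 'k) mpoly set" and r :: nat
  assume card: "card (UNIV :: 'n set) = 2 \<and> infinite (UNIV :: 'k set)"
    and I: "1 \<le> r \<and> (\<forall>j\<in>{1..r}. equigenerated (I j) \<and> I j \<noteq> {0} \<and>
      ideal_height mpoly_ring (I j) = 2 \<and> contracted (I j))"
  then have "\<forall>j\<in>{1..r}. \<exists>d. generated_in_degree d (I j)"
    using equigenerated_imp_generated_in_degree by blast
  then obtain d where "\<forall>j\<in>{1..r}. generated_in_degree (d j) (I j)"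
    using bchoice[of "{1..r}" "\<lambda>j d. generated_in_degree d (I j)"] by blast
  then have "int (min_num_gens mpoly_ring (\<Otimes>\<^bsub>ideals_set mpoly_ring\<^esub> j\<in>{1..r}. I j) + r)
      = int ((\<Sum>j=1..r. min_num_gens mpoly_ring (I j)) + 1)"
    using I card by (subst min_num_gens_finprod_contracted[of r d I]) auto
  then show "int (min_num_gens mpoly_ring (\<Otimes>\<^bsub>ideals_set mpoly_ring\<^esub> j\<in>{1..r}. I j))
      = (\<Sum>j=1..r. int (min_num_gens mpoly_ring (I j))) - (int r - 1)"
    by simp
next
  fix I :: "('n, 'k) mpoly set" and k :: nat
  assume card: "card (UNIV :: 'n set) = 2 \<and> infinite (UNIV :: 'k set)"
    and I: "equigenerated I \<and> I \<noteq> {0} \<and> ideal_height mpoly_ring I = 2 \<and> contracted I"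
  then obtain d where d: "generated_in_degree d I"
    using equigenerated_imp_generated_in_degree by blast
  have "int (min_num_gens mpoly_ring (I [^]\<^bsub>ideals_set mpoly_ring\<^esub> k) + k) = int (k * min_num_gens mpoly_ring I + 1)"
    using min_num_gens_finprod_contracted[of k "\<lambda>_. d" "\<lambda>_. I"] card I d
    by (subst of_nat_eq_iff) (simp add: pow_ideals_eq_finprod generated_in_degree_imp_ideal)
  then show "int (min_num_gens mpoly_ring (I [^]\<^bsub>ideals_set mpoly_ring\<^esub> k))
      = int k * (int (min_num_gens mpoly_ring I) - 1) + 1"
    by (simp add: algebra_simps)
qed

end
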